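(* Let $A\in\mathbb{R}^{d\times d}$ be symmetric, $b\in\mathbb{R}^d$, $R>0$, $\rho\ge0$, and let $f(x)=\frac12x^TAx+b^Tx$ and $f_\rho(x)=f(x)+\frac{\rho}{3}\|x\|^3$. Let $x_\star^{\mathsf{tr}}$ be a minimizer of $f$ over $\{\|x\|\le R\}$ and $x_\star^{\mathsf{cr}}$ a global minimizer of $f_\rho$ over $\mathbb{R}^d$. Let $0<\delta<1$, let $u$ be uniformly distributed on the unit sphere of $\mathbb{R}^d$, and for integers $t\ge1$ let $$\hat x^{\mathsf{tr}}_t\in\operatorname*{argmin}_{x\in\mathcal{K}_t(A,\{b,u\}),\,\|x\|\le R}f(x),\qquad\hat x^{\mathsf{cr}}_t\in\operatorname*{argmin}_{x\in\mathcal{K}_t(A,\{b,u\})}f_\rho(x).$$ Then with probability at least $1-\delta$ over the choice of $u$, for all integers $t\ge1$, $$f(\hat x^{\mathsf{tr}}_t)-f(x_\star^{\mathsf{tr}})\le\frac{(\lambda_{\max}-\lambda_{\min})R^2}{t^2}\left[4+\frac{\mathbb{I}_{\{\lambda_{\min}<0\}}}{2}\log^2\left(\frac{4d}{\delta^2}\right)\right]$$ and $$f_\rho(\hat x^{\mathsf{cr}}_t)-f_\rho(x_\star^{\mathsf{cr}})\le\frac{(\lambda_{\max}-\lambda_{\min})\|x_\star^{\mathsf{cr}}\|^2}{t^2}\left[4+\frac{\mathbb{I}_{\{\lambda_{\min}<0\}}}{2}\log^2\left(\frac{4d}{\delta^2}\right)\right].$$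
   Context: $\|\cdot\|$ is the Euclidean norm; $\lambda_{\min},\lambda_{\max}$ are the smallest and largest eigenvalues of $A$; $\mathbb{I}$ is an indicator ($0/1$ valued). The joint Krylov subspace is $\mathcal{K}_t(A,\{b,u\})=\mathrm{span}\{b,Ab,\dots,A^{t-1}b,u,Au,\dots,A^{t-1}u\}$. A global minimizer $x_\star^{\mathsf{cr}}$ is assumed to exist (automatic if $\rho>0$). *)

theory Defs
  imports "HOL-Probability.Probability"
begin

section \<open>Quadratic and cubic-regularized objectives\<close>

definition quad_obj :: "real^'d^'d \<Rightarrow> real^'d \<Rightarrow> real^'d \<Rightarrow> real" where
  "quad_obj A b x = 1/2 * (x \<bullet> (A *v x)) + b \<bullet> x"

definition cubic_obj :: "real^'d^'d \<Rightarrow> real^'d \<Rightarrow> real \<Rightarrow> real^'d \<Rightarrow> real" where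
  "cubic_obj A b \<rho> x = quad_obj A b x + \<rho> / 3 * norm x ^ 3"

section \<open>Extreme eigenvalues\<close>

definition eigvals :: "real^'d^'d \<Rightarrow> real set" where
  "eigvals A = {l. \<exists>v. v \<noteq> 0 \<and> A *v v = l *\<^sub>R v}"

text \<open>For symmetric \<open>A\<close> the set of eigenvalues is finite and nonempty, so the following
  minimum and maximum are attained; they are only used in that case.\<close>

definition lambda_min :: "real^'d^'d \<Rightarrow> real" where
  "lambda_min A = Min (eigvals A)"

definition lambda_max :: "real^'d^'d \<Rightarrow> real" where
  "lambda_max A = Max (eigvals A)"

section \<open>Joint Krylov subspaces\<close>

definition krylov :: "nat \<Rightarrow> real^'d^'d \<Rightarrow> (real^'d) set \<Rightarrow> (real^'d) set" where
  "krylov t A S = span {(((*v) A) ^^ k) v | k v. k < t \<and> v \<in> S}"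

section \<open>The uniform distribution on the unit sphere\<close>

text \<open>The normalized surface measure: a Borel set \<open>E\<close> of directions receives the fraction of
  the volume of the unit ball occupied by the points \<open>x\<close> with \<open>x / \<parallel>x\<parallel> \<in> E\<close>.  The origin, where
  \<open>sgn\<close> takes the value \<open>0\<close>, is a null set.  The lemmas below confirm that this is a probability
  measure concentrated on the sphere and invariant under all orthogonal transformations.  (The sort
  \<open>wellorder\<close> in the invariance lemma is inherited from \<open>measure_orthogonal_image\<close>; every finite
  dimension has such an index type.)\<close>

definition uniform_sphere :: "'a::euclidean_space measure" where
  "uniform_sphere = distr (uniform_measure lborel (ball 0 1)) borel sgn"

lemma sets_uniform_sphere [simp]: "sets uniform_sphere = sets borel"
  and space_uniform_sphere [simp]: "space uniform_sphere = UNIV"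
  by (simp_all add: uniform_sphere_def)

lemma borel_measurable_sgn_euclidean [measurable]:
  "(sgn :: 'a::euclidean_space \<Rightarrow> 'a) \<in> borel_measurable borel"
  unfolding sgn_div_norm [abs_def] by measurable

lemma emeasure_lborel_unit_ball:
  "emeasure lborel (ball (0::'a::euclidean_space) 1) \<noteq> 0"
  "emeasure lborel (ball (0::'a::euclidean_space) 1) \<noteq> \<infinity>"
proof -
  show "emeasure lborel (ball (0::'a) 1) \<noteq> \<infinity>"
    using emeasure_lborel_ball_finite[of "0::'a" 1] by auto
  show "emeasure lborel (ball (0::'a) 1) \<noteq> 0"
    by (simp add: emeasure_ball less_imp_neq [OF unit_ball_vol_pos, symmetric])
qed

lemma prob_space_uniform_sphere: "prob_space uniform_sphere"
  unfolding uniform_sphere_def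
proof (rule prob_space.prob_space_distr)
  show "prob_space (uniform_measure lborel (ball (0::'a) 1))"
    by (rule prob_space_uniform_measure) (fact emeasure_lborel_unit_ball)+
qed simp

lemma AE_uniform_sphere: "AE x in uniform_sphere. norm x = 1"
proof -
  have "AE x in lborel. x \<noteq> (0::'a)"
    by (rule AE_lborel_singleton)
  then have "AE x in uniform_measure lborel (ball (0::'a) 1). norm (sgn x) = 1"
    by (intro AE_uniform_measureI) (auto simp: norm_sgn)
  then show ?thesis
    unfolding uniform_sphere_def by (subst AE_distr_iff) auto
qed

lemma uniform_sphere_orthogonal_invariant:
  fixes T :: "real^'n::{finite,wellorder} \<Rightarrow> real^'n::_"
  assumes T: "orthogonal_transformation T"
  shows "distr uniform_sphere borel T = uniform_sphere"
proof -
  have lin: "linear T" and nrm: "norm (T x) = norm x" for x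
    using T by (auto simp: orthogonal_transformation)
  have mT [measurable]: "T \<in> borel_measurable borel"
    using lin by (intro borel_measurable_continuous_onI linear_continuous_on)
      (simp add: linear_conv_bounded_linear)
  have sgnT: "sgn (T x) = T (sgn x)" for x
    by (simp add: sgn_div_norm nrm linear_cmul[OF lin])
  let ?B = "ball (0::real^'n::_) 1"
  have "emeasure uniform_sphere (T -` E) = emeasure uniform_sphere E"
    if [measurable]: "E \<in> sets borel" for E :: "(real^'n::_) set"
  proof -
    define S where "S = ?B \<inter> sgn -` T -` E"
    have TE: "T -` E \<in> sets borel"
      using measurable_sets[OF mT that] by simp
    have vE: "sgn -` E \<in> sets (borel :: (real^'n::_) measure)"
      using measurable_sets[OF borel_measurable_sgn_euclidean that] by simp
    have vTE: "sgn -` T -` E \<in> sets (borel :: (real^'n::_) measure)"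
      using measurable_sets[OF borel_measurable_sgn_euclidean TE] by simp
    have Sm: "S \<in> sets borel" unfolding S_def using vTE by auto
    have fin: "emeasure lborel S < \<infinity>"
    proof -
      have "emeasure lborel S \<le> emeasure lborel ?B"
        unfolding S_def by (intro emeasure_mono) auto
      then show ?thesis
        using emeasure_lborel_unit_ball(2)[where 'a = "real^'n::_"] by (simp add: less_top top_unique)
    qed
    have Sl: "S \<in> lmeasurable"
      using Sm fin by (intro fmeasurableI) auto
    have surj: "surj T" using T by (rule orthogonal_transformation_surj)
    have im: "T ` S = ?B \<inter> sgn -` E"
    proof (intro set_eqI iffI)
      fix y assume "y \<in> T ` S"
      then show "y \<in> ?B \<inter> sgn -` E" by (auto simp: S_def nrm sgnT)
    next
      fix y assume y: "y \<in> ?B \<inter> sgn -` E"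
      obtain x where "y = T x" using surj by blast
      with y show "y \<in> T ` S" by (auto simp: S_def nrm sgnT)
    qed
    have "emeasure lborel (T ` S) = emeasure lborel S"
    proof -
      have a: "T ` S \<in> lmeasurable" and m: "measure lebesgue (T ` S) = measure lebesgue S"
        using measurable_orthogonal_image[OF T Sl] measure_orthogonal_image[OF T Sl] by auto
      have "emeasure lebesgue (T ` S) = emeasure lebesgue S"
        using m a Sl by (simp add: emeasure_eq_measure2)
      moreover have "T ` S \<in> sets lborel" unfolding im using vE by simp
      ultimately show ?thesis using Sm by simp
    qed
    then show ?thesis
      unfolding im unfolding S_def
      by (simp add: uniform_sphere_def emeasure_distr TE vE vTE)
  qed
  moreover have "T \<in> measurable uniform_sphere borel"
    using mT by (simp cong: measurable_cong_sets)
  ultimately show ?thesis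
    by (intro measure_eqI) (auto simp: emeasure_distr)
qed

end

theory Submission
  imports Defs
begin

text \<open>The trust-region and the cubic problem are treated together: \<open>xcr\<close> minimises \<open>f\<close> on the ball of
  radius \<open>\<parallel>xcr\<parallel>\<close>, where moreover \<open>f\<^sub>\<rho> - f \<le> \<rho>/3 \<parallel>xcr\<parallel>\<^sup>3\<close>, so it suffices to find, for every \<open>w\<close> in
  a ball of radius \<open>R\<close>, a point of the ball in the joint Krylov space whose value exceeds \<open>f w\<close> by at
  most the stated bound.

  Write \<open>l\<close> for the smallest eigenvalue and \<open>L\<close> for the spread of the spectrum. Running an accelerated
  proximal gradient method on \<open>f - l/2 \<parallel>\<cdot>\<parallel>\<^sup>2\<close>, whose gradient is \<open>L\<close>-Lipschitz, with \<open>max l 0 / 2 \<parallel>\<cdot>\<parallel>\<^sup>2\<close> and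
  the ball constraint in the proximal term, stays in the Krylov space of \<open>b\<close> and has error at most
  \<open>2 L R\<^sup>2/t\<^sup>2\<close>. This settles \<open>l \<ge> 0\<close>. If \<open>l < 0\<close>, the iterate is moved to the sphere along a unit vector \<open>z\<close>
  in the Krylov space of \<open>u\<close>, with the sign that does not increase the linear term; the quadratic term
  costs at most \<open>2 R\<^sup>2 (z \<bullet> A z - l)\<close>. A Lanczos-type polynomial yields \<open>z\<close> with
  \<open>z \<bullet> A z - l \<le> L (1 + log\<^sup>2(4d/\<delta>\<^sup>2)/4)/t\<^sup>2\<close> as soon as the component of \<open>u\<close> along a minimal eigenvector is at
  least \<open>3\<delta>/(8 \<surd>d)\<close>, which has probability at least \<open>1 - \<delta>\<close>.\<close>

section \<open>Spectral decomposition of symmetric matrices\<close>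

lemma inner_matrix_symmetric:
  fixes A :: "real^'n^'n"
  assumes "transpose A = A"
  shows "x \<bullet> (A *v y) = (A *v x) \<bullet> y"
  using dot_lmul_matrix[of x A y] assms by (metis transpose_matrix_vector)

lemma symmetric_matrix_invariant_subspace_eigenvector:
  fixes A :: "real^'n^'n"
  assumes sym: "transpose A = A" and S: "subspace S" and inv: "\<And>x. x \<in> S \<Longrightarrow> A *v x \<in> S"
    and nz: "S \<noteq> {0}"
  shows "\<exists>v\<in>S. norm v = 1 \<and> (\<exists>l. A *v v = l *\<^sub>R v)"
proof -
  \<comment> \<open>maximise the Rayleigh quotient over \<open>S\<close>\<close>
  obtain w where w: "w \<in> S" "w \<noteq> 0"
    using nz subspace_0[OF S] by auto
  have "compact (sphere 0 1 \<inter> S)"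
    using closed_subspace[OF S] by (intro compact_Int_closed) auto
  moreover have "(1 / norm w) *\<^sub>R w \<in> sphere 0 1 \<inter> S"
    using w S by (auto simp: subspace_scale)
  moreover have cont: "continuous_on (sphere 0 1 \<inter> S) (\<lambda>x. x \<bullet> (A *v x))"
    by (intro continuous_intros linear_continuous_on matrix_vector_mul_bounded_linear)
  ultimately obtain v where v: "v \<in> sphere 0 1 \<inter> S"
      and max: "\<And>x. x \<in> sphere 0 1 \<inter> S \<Longrightarrow> x \<bullet> (A *v x) \<le> v \<bullet> (A *v v)"
    using continuous_attains_sup[of "sphere 0 1 \<inter> S" "\<lambda>x. x \<bullet> (A *v x)", OF _ _ cont]
    by blast
  define l where "l = v \<bullet> (A *v v)"
  have nv: "norm v = 1" and vS: "v \<in> S" and vv: "v \<bullet> v = 1"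
    using v by (auto simp: norm_eq_1)
  have max': "x \<bullet> (A *v x) \<le> l * (x \<bullet> x)" if "x \<in> S" for x
  proof (cases "x = 0")
    case False
    have "(1 / norm x) *\<^sub>R x \<in> sphere 0 1 \<inter> S"
      using that False S by (auto simp: subspace_scale)
    from max[OF this] have "(1 / norm x)\<^sup>2 * (x \<bullet> (A *v x)) \<le> l"
      by (simp add: l_def matrix_vector_mult_scaleR power2_eq_square)
    with False show ?thesis
      by (simp add: field_simps power2_norm_eq_inner)
  qed simp
  \<comment> \<open>The residual lies in \<open>S\<close> and is orthogonal to \<open>v\<close>.
    Comparing \<open>v\<close> with \<open>v + t *\<^sub>R q\<close> bounds the first-order gain
    \<open>2 t (q \<bullet> q)\<close> by a multiple of \<open>t\<^sup>2\<close>, so the residual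
    must vanish.\<close>
  define q where "q = A *v v - l *\<^sub>R v"
  have qS: "q \<in> S"
    unfolding q_def using vS S inv by (simp add: subspace_diff subspace_scale)
  have qv: "q \<bullet> v = 0"
    by (simp add: q_def inner_diff_left vv l_def inner_commute[of "A *v v"])
  have qA: "q \<bullet> (A *v v) = q \<bullet> q"
  proof -
    have "A *v v = q + l *\<^sub>R v" by (simp add: q_def)
    then show ?thesis by (simp add: inner_add_right qv)
  qed
  define c where "c = l * (q \<bullet> q) - q \<bullet> (A *v q)"
  have quad: "2 * t * (q \<bullet> q) \<le> t\<^sup>2 * c" for t
  proof -
    have "(v + t *\<^sub>R q) \<bullet> (A *v (v + t *\<^sub>R q)) \<le> l * ((v + t *\<^sub>R q) \<bullet> (v + t *\<^sub>R q))"
      using vS qS S by (intro max') (simp add: subspace_add subspace_scale)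
    moreover have "v \<bullet> (A *v q) = q \<bullet> q"
      using inner_matrix_symmetric[OF sym, of v q] qA by (simp add: inner_commute)
    ultimately show ?thesis
      using qv qA vv
      by (simp add: c_def matrix_vector_right_distrib matrix_vector_mult_scaleR inner_add_left
          inner_add_right power2_eq_square algebra_simps inner_commute flip: l_def)
  qed
  have "q \<bullet> q = 0"
  proof (rule ccontr)
    assume "q \<bullet> q \<noteq> 0"
    then have pos: "q \<bullet> q > 0" by auto
    \<comment> \<open>Small enough for \<open>t * c \<le> q \<bullet> q\<close>, so that
      \<open>quad\<close> would give
      \<open>2 t (q \<bullet> q) \<le> t (q \<bullet> q)\<close>.\<close>
    define t where "t = (q \<bullet> q) / (\<bar>c\<bar> + 1)"
    have t: "t > 0" using pos by (simp add: t_def)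
    have "t * c \<le> t * (\<bar>c\<bar> + 1)" using t by simp
    also have "\<dots> = q \<bullet> q" by (simp add: t_def)
    finally have "t * (t * c) \<le> t * (q \<bullet> q)" using t by simp
    moreover have "t * (q \<bullet> q) > 0" using t pos by simp
    ultimately show False using quad[of t] by (simp add: power2_eq_square algebra_simps)
  qed
  then have "A *v v = l *\<^sub>R v" by (simp add: q_def)
  with vS nv show ?thesis by blast
qed

text \<open>Induction on the dimension: by symmetry the orthogonal complement of an eigenvector
  within \<open>S\<close> is again invariant.\<close>

lemma symmetric_matrix_invariant_subspace_eigenbasis:
  fixes A :: "real^'n^'n"
  assumes sym: "transpose A = A" and S: "subspace S" and inv: "\<And>x. x \<in> S \<Longrightarrow> A *v x \<in> S"
  shows "\<exists>B. finite B \<and> pairwise orthogonal B \<and> (\<forall>v\<in>B. norm v = 1) \<and> span B = S \<and>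
           (\<forall>v\<in>B. \<exists>l. A *v v = l *\<^sub>R v)"
  using S inv
proof (induction "dim S" arbitrary: S rule: less_induct)
  case less
  show ?case
  proof (cases "S = {0}")
    case True
    then show ?thesis by (intro exI[of _ "{}"]) auto
  next
    case False
    obtain v l where v: "v \<in> S" "norm v = 1" "A *v v = l *\<^sub>R v"
      using symmetric_matrix_invariant_subspace_eigenvector[OF sym less.prems False] by blast
    have vv: "v \<bullet> v = 1" using v(2) by (simp add: norm_eq_1)
    define S' where "S' = S \<inter> {x. v \<bullet> x = 0}"
    have sub': "subspace S'"
      unfolding S'_def using less.prems(1) by (intro subspace_inter) (auto intro: subspace_hyperplane)
    have inv': "A *v x \<in> S'" if "x \<in> S'" for x
      using that less.prems(2) inner_matrix_symmetric[OF sym, of v x] v(3) by (auto simp: S'_def)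
    have "v \<notin> S'" "S' \<subseteq> S" using vv by (auto simp: S'_def)
    with v(1) have "S' \<subset> S" by blast
    then have "dim S' < dim S"
      using dim_psubset[of S' S] sub' less.prems(1) unfolding span_eq_iff[THEN iffD2, OF sub'] span_eq_iff[THEN iffD2, OF less.prems(1)] by blast
    from less.hyps[OF this sub' inv'] obtain B where B: "finite B" "pairwise orthogonal B"
        "\<forall>v\<in>B. norm v = 1" "span B = S'" "\<forall>v\<in>B. \<exists>l. A *v v = l *\<^sub>R v"
      by blast
    have BS: "B \<subseteq> S'" using B(4) span_superset by blast
    have "pairwise orthogonal (insert v B)"
      using B(2) BS by (auto simp: pairwise_insert orthogonal_def S'_def inner_commute)
    moreover have "span (insert v B) = S"
    proof
      show "span (insert v B) \<subseteq> S"
        using BS v(1) less.prems(1) by (intro span_minimal) (auto simp: S'_def)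
      show "S \<subseteq> span (insert v B)"
      proof
        fix x assume "x \<in> S"
        then have "x - (v \<bullet> x) *\<^sub>R v \<in> S'"
          using v(1) less.prems(1) vv
          by (auto simp: S'_def subspace_diff subspace_scale inner_diff_right)
        then show "x \<in> span (insert v B)"
            unfolding span_insert B(4) by blast
      qed
    qed
    ultimately show ?thesis
      using B(1,3,5) v(2,3) by (intro exI[of _ "insert v B"]) auto
  qed
qed

lemma inner_orthonormal_basis_expand:
  fixes x :: "'a::euclidean_space"
  assumes "finite B" "pairwise orthogonal B" "\<And>v. v \<in> B \<Longrightarrow> norm v = 1" "span B = UNIV"
  shows "x \<bullet> y = (\<Sum>v\<in>B. (x \<bullet> v) * (y \<bullet> v))"
proof -
  have "x \<bullet> y = (\<Sum>v\<in>B. (x \<bullet> v) *\<^sub>R v) \<bullet> y"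
    using orthonormal_basis_expand[OF assms(2), of x] assms by simp
  then show ?thesis by (simp add: inner_sum_left inner_commute[of y])
qed

text \<open>On a unit eigenvector the Rayleigh quotient is the eigenvalue, so it serves as a choice-free
  name for the eigenvalue of each member of an orthonormal eigenbasis.\<close>

definition eigval_of :: "real^'n^'n \<Rightarrow> real^'n \<Rightarrow> real" where
  "eigval_of A v = v \<bullet> (A *v v)"

text \<open>In the coordinates \<open>x \<bullet> v\<close> the matrix acts diagonally, so quadratic
  forms and polynomials in \<open>A\<close> are computed coordinatewise.\<close>

locale symmetric_eigenbasis =
  fixes A :: "real^'n^'n" and B :: "(real^'n) set"
  assumes sym: "transpose A = A"
    and fin: "finite B" and orth: "pairwise orthogonal B"
    and unit: "\<And>v. v \<in> B \<Longrightarrow> norm v = 1" and span: "span B = UNIV"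
    and eig: "\<And>v. v \<in> B \<Longrightarrow> \<exists>l. A *v v = l *\<^sub>R v"
begin

lemma unit_inner: "v \<in> B \<Longrightarrow> v \<bullet> v = 1"
  using unit by (simp add: norm_eq_1)

lemma eigval_of: "v \<in> B \<Longrightarrow> A *v v = eigval_of A v *\<^sub>R v"
  using eig unit_inner by (fastforce simp: eigval_of_def)

lemma inner_expand: "x \<bullet> y = (\<Sum>v\<in>B. (x \<bullet> v) * (y \<bullet> v))"
  using inner_orthonormal_basis_expand fin orth unit span by blast

lemma mult_inner: "v \<in> B \<Longrightarrow> (A *v x) \<bullet> v = eigval_of A v * (x \<bullet> v)"
  using inner_matrix_symmetric[OF sym, of x v] eigval_of[of v] by simp

text \<open>Every eigenvector has a nonzero coordinate along some basis vector, and comparing that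
  coordinate identifies its eigenvalue. Finiteness of \<open>B\<close> then gives access to
  \<open>Min\<close> and \<open>Max\<close>.\<close>

lemma eigvals_eq: "eigvals A = eigval_of A ` B"
proof
  show "eigval_of A ` B \<subseteq> eigvals A"
  proof
    fix l assume "l \<in> eigval_of A ` B"
    then obtain v where "v \<in> B" "l = eigval_of A v" by blast
    then have "v \<noteq> 0 \<and> A *v v = l *\<^sub>R v" using eigval_of[of v] unit[of v] by auto
    then show "l \<in> eigvals A" by (auto simp: eigvals_def)
  qed
  show "eigvals A \<subseteq> eigval_of A ` B"
  proof
    fix l assume "l \<in> eigvals A"
    then obtain w where w: "w \<noteq> 0" "A *v w = l *\<^sub>R w" by (auto simp: eigvals_def)
    have "\<exists>v\<in>B. w \<bullet> v \<noteq> 0"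
    proof (rule ccontr)
      assume "\<not> ?thesis"
      then have "w \<bullet> w = 0" unfolding inner_expand[of w w] by (intro sum.neutral) simp
      with w(1) show False by simp
    qed
    then obtain v where v: "v \<in> B" "w \<bullet> v \<noteq> 0" by blast
    have "l * (w \<bullet> v) = eigval_of A v * (w \<bullet> v)"
      using mult_inner[OF v(1), of w] w(2) by simp
    with v show "l \<in> eigval_of A ` B" by auto
  qed
qed

lemma nonempty: "B \<noteq> {}"
proof
  assume "B = {}"
  then have "(UNIV :: (real^'n) set) = {0}" using span by simp
  then have "(axis undefined 1 :: real^'n) = 0" by blast
  then show False by simp
qed

lemma eigval_of_bounds: "v \<in> B \<Longrightarrow> lambda_min A \<le> eigval_of A v" "v \<in> B \<Longrightarrow> eigval_of A v \<le> lambda_max A"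
  using fin by (auto simp: lambda_min_def lambda_max_def eigvals_eq)

lemma lambda_min_attained: "\<exists>v\<in>B. eigval_of A v = lambda_min A"
proof -
  have "lambda_min A \<in> eigval_of A ` B"
    unfolding lambda_min_def eigvals_eq using fin nonempty by (intro Min_in) auto
  then show ?thesis by auto
qed

lemma quadratic_form: "x \<bullet> (A *v x) = (\<Sum>v\<in>B. eigval_of A v * (x \<bullet> v)\<^sup>2)"
  unfolding inner_expand[of x "A *v x"]
  by (intro sum.cong) (simp_all add: mult_inner power2_eq_square)

lemma norm_sq: "(norm x)\<^sup>2 = (\<Sum>v\<in>B. (x \<bullet> v)\<^sup>2)"
  using inner_expand[of x x] by (simp only: power2_norm_eq_inner) (simp add: power2_eq_square)

lemma quadratic_form_bounds:
  "lambda_min A * (norm x)\<^sup>2 \<le> x \<bullet> (A *v x)" "x \<bullet> (A *v x) \<le> lambda_max A * (norm x)\<^sup>2"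
  unfolding quadratic_form norm_sq sum_distrib_left
  by (intro sum_mono mult_right_mono eigval_of_bounds; simp)+

end

lemma symmetric_eigenbasis_exists:
  fixes A :: "real^'n^'n"
  assumes "transpose A = A"
  shows "\<exists>B. symmetric_eigenbasis A B"
proof -
  obtain B where "finite B" "pairwise orthogonal B" "\<forall>v\<in>B. norm v = 1" "span B = UNIV"
      "\<forall>v\<in>B. \<exists>l. A *v v = l *\<^sub>R v"
    using symmetric_matrix_invariant_subspace_eigenbasis[OF assms, of UNIV] by auto
  then have "symmetric_eigenbasis A B" using assms by unfold_locales auto
  then show ?thesis ..
qed

section \<open>Acceleration in Krylov subspaces\<close>

lemma subspace_krylov: "subspace (krylov t A S)"
  by (simp add: krylov_def)

lemma krylov_mono:
  assumes "s \<le> t" "S \<subseteq> T"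
  shows "krylov s A S \<subseteq> krylov t A T"
  unfolding krylov_def using assms by (intro span_mono) fastforce

lemma krylov_base: "v \<in> S \<Longrightarrow> v \<in> krylov (Suc t) A S"
  unfolding krylov_def by (intro span_base CollectI exI[of _ 0] exI[of _ v]) simp

lemma krylov_mult:
  assumes "x \<in> krylov t A S"
  shows "A *v x \<in> krylov (Suc t) A S"
  using assms unfolding krylov_def
proof (induction rule: span_induct_alt)
  case base
  then show ?case by (simp add: span_zero)
next
  case (step c x y)
  then obtain k v where kv: "x = (((*v) A) ^^ k) v" "k < t" "v \<in> S" by blast
  have "A *v x \<in> {(((*v) A) ^^ k) v | k v. k < Suc t \<and> v \<in> S}"
    using kv by (intro CollectI exI[of _ "Suc k"] exI[of _ v]) auto
  then show ?case
    unfolding matrix_vector_right_distrib matrix_vector_mult_scaleR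
    by (intro span_add span_scale span_base step.IH)
qed

text \<open>The minimiser of \<open>c/2 \<parallel>p\<parallel>\<^sup>2 - v \<bullet> p\<close> on
  the ball is \<open>v/c\<close>, or \<open>R v/\<parallel>v\<parallel>\<close> if that point lies
  outside, hence a multiple of \<open>v\<close>; the extra term on the left is strong
  convexity.\<close>

lemma prox_ball:
  fixes v :: "'a::real_inner"
  assumes "c \<ge> 0" "R \<ge> 0"
  shows "\<exists>s. norm (s *\<^sub>R v) \<le> R \<and>
    (\<forall>w. norm w \<le> R \<longrightarrow>
      c/2 * (norm (s *\<^sub>R v))\<^sup>2 - v \<bullet> (s *\<^sub>R v) + c/2 * (norm (w - s *\<^sub>R v))\<^sup>2
        \<le> c/2 * (norm w)\<^sup>2 - v \<bullet> w)"
proof -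
  \<comment> \<open>The two sides differ by exactly
    \<open>(c *\<^sub>R p - v) \<bullet> (w - p)\<close>, so first-order optimality
    suffices.\<close>
  have key: "c/2 * (norm p)\<^sup>2 - v \<bullet> p + c/2 * (norm (w - p))\<^sup>2 \<le> c/2 * (norm w)\<^sup>2 - v \<bullet> w"
    if "(c *\<^sub>R p - v) \<bullet> (w - p) \<ge> 0" for p w
    using that by (simp add: power2_norm_eq_inner algebra_simps inner_diff_left inner_diff_right
        inner_commute)
  show ?thesis
  proof (cases "norm v \<le> c * R")
    case True
    show ?thesis
    proof (cases "c = 0")
      case True
      with \<open>norm v \<le> c * R\<close> show ?thesis using assms by (intro exI[of _ 0]) auto
    next
      case False
      then have "c > 0" using assms by simp
      then have "norm ((1/c) *\<^sub>R v) \<le> R"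
        using True by (simp add: field_simps)
      moreover have "(c *\<^sub>R ((1/c) *\<^sub>R v) - v) \<bullet> (w - (1/c) *\<^sub>R v) \<ge> 0" for w
        using \<open>c > 0\<close> by simp
      ultimately show ?thesis using key by (intro exI[of _ "1/c"]) blast
    qed
  next
    case False
    then have "norm v > 0" using assms by (smt (verit) mult_nonneg_nonneg norm_ge_zero)
    define s where "s = R / norm v"
    have s: "s \<ge> 0" "c * s \<le> 1" "norm (s *\<^sub>R v) = R" "v \<bullet> (s *\<^sub>R v) = R * norm v"
      using False \<open>norm v > 0\<close> assms
      by (auto simp: s_def field_simps power2_norm_eq_inner[symmetric] power2_eq_square)
    have "(c *\<^sub>R (s *\<^sub>R v) - v) \<bullet> (w - s *\<^sub>R v) \<ge> 0" if "norm w \<le> R" for w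
    proof -
      have "v \<bullet> w \<le> R * norm v"
        using norm_cauchy_schwarz[of v w] that mult_left_mono[OF that, of "norm v"]
        by (simp add: mult.commute)
      then have "(1 - c * s) * (v \<bullet> (s *\<^sub>R v) - v \<bullet> w) \<ge> 0"
        using s by (intro mult_nonneg_nonneg) auto
      then show ?thesis by (simp add: algebra_simps inner_diff_left inner_diff_right)
    qed
    then have "c/2 * (norm (s *\<^sub>R v))\<^sup>2 - v \<bullet> (s *\<^sub>R v) + c/2 * (norm (w - s *\<^sub>R v))\<^sup>2
        \<le> c/2 * (norm w)\<^sup>2 - v \<bullet> w" if "norm w \<le> R" for w
      using key that by blast
    moreover have "norm (s *\<^sub>R v) \<le> R" using s(3) by simp
    ultimately show ?thesis by blast
  qed
qed

text \<open>Accelerated proximal gradient method with momentum weights \<open>2/(k+2)\<close>; the iterates stay in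
  the Krylov space since the proximal map of \<open>\<mu>/2 \<parallel>\<cdot>\<parallel>\<^sup>2\<close> restricted to a centred ball only rescales.\<close>

lemma krylov_accelerated_gradient:
  fixes A :: "real^'n^'n" and b :: "real^'n"
  assumes sym: "transpose A = A"
    and lo: "\<And>x. m * (norm x)\<^sup>2 \<le> x \<bullet> (A *v x)"
    and hi: "\<And>x. x \<bullet> (A *v x) \<le> (m + L) * (norm x)\<^sup>2"
    and L: "L \<ge> 0" and mu: "\<mu> \<ge> 0" and R: "R \<ge> 0"
  defines "F \<equiv> \<lambda>x. quad_obj A b x - m/2 * (norm x)\<^sup>2 + \<mu>/2 * (norm x)\<^sup>2"
  shows "\<exists>x z. x \<in> krylov k A {b} \<and> z \<in> krylov k A {b} \<and> norm x \<le> R \<and> norm z \<le> R \<and>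
    (\<forall>w. norm w \<le> R \<longrightarrow>
      real k * (real k + 1) / 4 * (F x - F w) + L/2 * (norm (w - z))\<^sup>2 \<le> L/2 * (norm w)\<^sup>2)"
\<comment> \<open>For fixed \<open>w\<close> the left-hand side is a potential that does not
  increase along the iteration; \<open>x\<close> is the averaged iterate, \<open>z\<close> the
  proximal one.\<close>
proof (induction k)
  case 0
  show ?case using R subspace_0[OF subspace_krylov]
    by (intro exI[of _ 0]) auto
next
  case (Suc k)
  then obtain x z where xz: "x \<in> krylov k A {b}" "z \<in> krylov k A {b}" "norm x \<le> R" "norm z \<le> R"
    and IH: "\<And>w. norm w \<le> R \<Longrightarrow>
      real k * (real k + 1) / 4 * (F x - F w) + L/2 * (norm (w - z))\<^sup>2 \<le> L/2 * (norm w)\<^sup>2"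
    by blast
  define G where "G x = quad_obj A b x - m/2 * (norm x)\<^sup>2" for x
  define h where "h x = \<mu>/2 * (norm x)\<^sup>2" for x :: "real^'n"
  have F: "F x = G x + h x" for x by (simp add: F_def G_def h_def)
  \<comment> \<open>With \<open>C = (k+1)(k+2)/4\<close> the weights satisfy
    \<open>C (1 - \<theta>) = k(k+1)/4\<close> and \<open>C \<theta> \<beta> = L\<close>, so the
    potential telescopes; and \<open>L \<theta>\<^sup>2 \<le> \<theta> \<beta>\<close> lets the
    proximal term absorb the smoothness error.\<close>
  define \<theta> where "\<theta> = 2 / (real k + 2)"
  define \<beta> where "\<beta> = 2 * L / (real k + 1)"
  have th: "0 \<le> \<theta>" "\<theta> \<le> 1" by (auto simp: \<theta>_def field_simps)
  have be: "\<beta> \<ge> 0" using L by (simp add: \<beta>_def)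
  define y where "y = (1 - \<theta>) *\<^sub>R x + \<theta> *\<^sub>R z"
  define g where "g = A *v y - m *\<^sub>R y + b"
  define Q where "Q x = x \<bullet> (A *v x) - m * (norm x)\<^sup>2" for x
  \<comment> \<open>\<open>G\<close> is quadratic, so the expansion is exact; subtracting
    \<open>m\<close> leaves \<open>Q\<close> between \<open>0\<close> and
    \<open>L \<parallel>x\<parallel>\<^sup>2\<close>, which gives convexity and smoothness
    together.\<close>
  have taylor: "G w = G y + g \<bullet> (w - y) + Q (w - y) / 2" for w
  proof -
    define r where "r = w - y"
    have w: "w = y + r" by (simp add: r_def)
    have "y \<bullet> (A *v r) = (A *v y) \<bullet> r" by (rule inner_matrix_symmetric[OF sym])
    then show ?thesis
      by (simp add: w G_def Q_def quad_obj_def g_def power2_norm_eq_inner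
          matrix_vector_right_distrib inner_diff_left inner_diff_right inner_add_left inner_add_right
          inner_commute field_simps)
  qed
  have Q: "0 \<le> Q x" "Q x \<le> L * (norm x)\<^sup>2" for x
    using lo[of x] hi[of x] by (auto simp: Q_def algebra_simps)
  have convex: "G y + g \<bullet> (w - y) \<le> G w" for w
    using taylor[of w] Q(1)[of "w - y"] by simp
  have smooth: "G w \<le> G y + g \<bullet> (w - y) + L/2 * (norm (w - y))\<^sup>2" for w
    using taylor[of w] Q(2)[of "w - y"] by simp
  \<comment> \<open>Completing squares, minimising \<open>g \<bullet> p + h p + \<beta>/2
    \<parallel>p - z\<parallel>\<^sup>2\<close> over the ball is \<open>prox_ball\<close> with
    \<open>c = \<beta> + \<mu>\<close> and this \<open>v\<close>.\<close>
  define v where "v = \<beta> *\<^sub>R z - g"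
  obtain s where s: "norm (s *\<^sub>R v) \<le> R"
    and prox: "\<And>w. norm w \<le> R \<Longrightarrow>
      (\<beta> + \<mu>)/2 * (norm (s *\<^sub>R v))\<^sup>2 - v \<bullet> (s *\<^sub>R v) + (\<beta> + \<mu>)/2 * (norm (w - s *\<^sub>R v))\<^sup>2
        \<le> (\<beta> + \<mu>)/2 * (norm w)\<^sup>2 - v \<bullet> w"
    using prox_ball[OF add_nonneg_nonneg[OF be mu] R, of v] by blast
  define z' where "z' = s *\<^sub>R v"
  define x' where "x' = (1 - \<theta>) *\<^sub>R x + \<theta> *\<^sub>R z'"
  note sub = subspace_krylov[of "Suc k" A "{b}"]
  have xzk: "x \<in> krylov (Suc k) A {b}" "z \<in> krylov (Suc k) A {b}"
    using xz krylov_mono[of k "Suc k" "{b}" "{b}" A] by auto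
  have "y \<in> krylov k A {b}"
    unfolding y_def using xz subspace_krylov by (intro subspace_add subspace_scale)
  then have "A *v y \<in> krylov (Suc k) A {b}" "y \<in> krylov (Suc k) A {b}"
    using krylov_mult krylov_mono[of k "Suc k" "{b}" "{b}" A] by auto
  then have "v \<in> krylov (Suc k) A {b}"
    unfolding v_def g_def using xzk krylov_base[of b "{b}" k A]
    by (intro subspace_diff[OF sub] subspace_add[OF sub] subspace_scale[OF sub]) auto
  then have z'k: "z' \<in> krylov (Suc k) A {b}"
    unfolding z'_def by (intro subspace_scale[OF sub])
  have x'k: "x' \<in> krylov (Suc k) A {b}"
    unfolding x'_def using xzk z'k by (intro subspace_add[OF sub] subspace_scale[OF sub])
  have z'R: "norm z' \<le> R" using s by (simp add: z'_def)
  have "norm x' \<le> (1 - \<theta>) * norm x + \<theta> * norm z'"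
    unfolding x'_def using th by (intro norm_triangle_le) simp
  also have "\<dots> \<le> (1 - \<theta>) * R + \<theta> * R"
    using th xz z'R by (intro add_mono mult_left_mono) auto
  finally have x'R: "norm x' \<le> R" by (simp add: algebra_simps)
  have three_point: "g \<bullet> z' + h z' + \<beta>/2 * (norm (z' - z))\<^sup>2 + \<beta>/2 * (norm (w - z'))\<^sup>2
      \<le> g \<bullet> w + h w + \<beta>/2 * (norm (w - z))\<^sup>2" if "norm w \<le> R" for w
  proof -
    have "(\<beta> + \<mu>)/2 * (norm z')\<^sup>2 - v \<bullet> z' + (\<beta> + \<mu>)/2 * (norm (w - z'))\<^sup>2
        \<le> (\<beta> + \<mu>)/2 * (norm w)\<^sup>2 - v \<bullet> w"
      using prox[OF that] by (simp add: z'_def)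
    moreover have "0 \<le> \<mu>/2 * (norm (w - z'))\<^sup>2" using mu by simp
    moreover have eq: "(\<beta> + \<mu>)/2 * (norm p)\<^sup>2 - v \<bullet> p
        = g \<bullet> p + h p + \<beta>/2 * (norm (p - z))\<^sup>2 - \<beta>/2 * (norm z)\<^sup>2" for p
      by (simp add: v_def h_def power2_norm_eq_inner inner_diff_left inner_diff_right inner_commute
          field_simps)
    moreover have "(\<beta> + \<mu>)/2 * (norm (w - z'))\<^sup>2
        = \<beta>/2 * (norm (w - z'))\<^sup>2 + \<mu>/2 * (norm (w - z'))\<^sup>2"
      by (simp add: field_simps)
    ultimately show ?thesis using eq[of z'] eq[of w] by linarith
  qed
  have hconv: "h x' \<le> (1 - \<theta>) * h x + \<theta> * h z'"
  proof -
    have "(1 - \<theta>) * (norm x)\<^sup>2 + \<theta> * (norm z')\<^sup>2 - (norm x')\<^sup>2 = \<theta> * (1 - \<theta>) * (norm (x - z'))\<^sup>2"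
      by (simp add: x'_def power2_norm_eq_inner inner_diff_left inner_diff_right inner_add_left
          inner_add_right inner_commute algebra_simps)
    moreover have "\<dots> \<ge> 0" using th by simp
    ultimately have "(norm x')\<^sup>2 \<le> (1 - \<theta>) * (norm x)\<^sup>2 + \<theta> * (norm z')\<^sup>2" by linarith
    then have "h x' \<le> \<mu>/2 * ((1 - \<theta>) * (norm x)\<^sup>2 + \<theta> * (norm z')\<^sup>2)"
      using mu by (simp add: h_def mult_left_mono)
    also have "\<dots> = (1 - \<theta>) * h x + \<theta> * h z'"
      by (simp add: h_def field_simps)
    finally show ?thesis .
  qed
  have step: "F x' - F w \<le> (1 - \<theta>) * (F x - F w)
      + \<theta> * \<beta>/2 * ((norm (w - z))\<^sup>2 - (norm (w - z'))\<^sup>2)" if w: "norm w \<le> R" for w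
  proof -
    \<comment> \<open>Both points average with the same \<open>x\<close>, so the displacement
      carries a factor \<open>\<theta>\<close> and the smoothness error a factor
      \<open>\<theta>\<^sup>2\<close>.\<close>
    have dx: "x' - y = \<theta> *\<^sub>R (z' - z)" by (simp add: x'_def y_def algebra_simps)
    have "G x' \<le> G y + g \<bullet> (x' - y) + L/2 * (\<theta>\<^sup>2 * (norm (z' - z))\<^sup>2)"
      using smooth[of x'] by (simp add: dx power_mult_distrib)
    also have "g \<bullet> (x' - y) = (1 - \<theta>) * (g \<bullet> (x - y)) + \<theta> * (g \<bullet> (z' - y))"
      by (simp add: x'_def inner_diff_right inner_add_right algebra_simps)
    also have "L/2 * (\<theta>\<^sup>2 * (norm (z' - z))\<^sup>2) \<le> \<theta> * \<beta>/2 * (norm (z' - z))\<^sup>2"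
    proof -
      have "L * \<theta>\<^sup>2 \<le> \<theta> * \<beta>"
        unfolding \<theta>_def \<beta>_def using L
        by (simp add: power2_eq_square divide_simps) (simp add: algebra_simps)
      from mult_right_mono[OF this, of "(norm (z' - z))\<^sup>2"] show ?thesis by (simp add: mult_ac)
    qed
    finally have "G x' \<le> (1 - \<theta>) * (G y + g \<bullet> (x - y))
        + \<theta> * (G y + g \<bullet> (z' - y) + \<beta>/2 * (norm (z' - z))\<^sup>2)"
      by (simp add: algebra_simps)
    also have "\<dots> \<le> (1 - \<theta>) * G x + \<theta> * (G y + g \<bullet> (z' - y) + \<beta>/2 * (norm (z' - z))\<^sup>2)"
      using th convex[of x] by (intro add_right_mono mult_left_mono) auto
    finally have "F x' \<le> (1 - \<theta>) * F x
        + \<theta> * (G y + g \<bullet> (z' - y) + \<beta>/2 * (norm (z' - z))\<^sup>2 + h z')"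
      using hconv by (simp add: F algebra_simps)
    also have "G y + g \<bullet> (z' - y) + \<beta>/2 * (norm (z' - z))\<^sup>2 + h z'
        \<le> F w + \<beta>/2 * (norm (w - z))\<^sup>2 - \<beta>/2 * (norm (w - z'))\<^sup>2"
      using three_point[OF w] convex[of w] by (simp add: F inner_diff_right)
    finally have "F x' \<le> (1 - \<theta>) * F x
        + \<theta> * (F w + \<beta>/2 * (norm (w - z))\<^sup>2 - \<beta>/2 * (norm (w - z'))\<^sup>2)"
      using th by (simp add: mult_left_mono)
    then show ?thesis by (simp add: algebra_simps)
  qed
  have "real (Suc k) * (real (Suc k) + 1) / 4 * (F x' - F w) + L/2 * (norm (w - z'))\<^sup>2
      \<le> L/2 * (norm w)\<^sup>2" if w: "norm w \<le> R" for w
  proof -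
    define C where "C = real (Suc k) * (real (Suc k) + 1) / 4"
    have C': "C = (real k + 1) * (real k + 2) / 4" by (simp add: C_def algebra_simps)
    have C1: "C * (1 - \<theta>) = real k * (real k + 1) / 4"
      unfolding C' \<theta>_def by (simp add: divide_simps)
    have C2: "C * (\<theta> * \<beta>) = L"
      unfolding C' \<theta>_def \<beta>_def by (simp add: divide_simps)
    have "C \<ge> 0" by (simp add: C_def)
    from mult_left_mono[OF step[OF w] this]
    have "C * (F x' - F w) \<le> C * (1 - \<theta>) * (F x - F w)
        + C * (\<theta> * \<beta>) / 2 * ((norm (w - z))\<^sup>2 - (norm (w - z'))\<^sup>2)"
      by (simp add: algebra_simps)
    then have "C * (F x' - F w) \<le> real k * (real k + 1) / 4 * (F x - F w)
        + L/2 * (norm (w - z))\<^sup>2 - L/2 * (norm (w - z'))\<^sup>2"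
      unfolding C1 C2 by (simp only: right_diff_distrib)
    then show ?thesis using IH[OF w] unfolding C_def by linarith
  qed
  with x'k z'k x'R z'R show ?case by blast
qed

section \<open>Approximate minimal eigenvectors in Krylov subspaces\<close>

text \<open>The substitution \<open>s = cos\<^sup>2 \<theta>\<close> turns \<open>lanczos_poly n\<close> into \<open>cos ((2n+1) \<theta>) / cos \<theta>\<close>.  Among
  polynomials \<open>p\<close> of degree \<open>n\<close> with \<open>s p(s)\<^sup>2 \<le> 1\<close> on \<open>[0, 1]\<close> it grows fastest to the left of \<open>0\<close>;
  the factor \<open>s\<close> is the shifted eigenvalue in the Rayleigh quotient.\<close>

fun lanczos_poly :: "nat \<Rightarrow> real \<Rightarrow> real" where
  "lanczos_poly 0 s = 1"
| "lanczos_poly (Suc 0) s = 4 * s - 3"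
| "lanczos_poly (Suc (Suc n)) s = (4 * s - 2) * lanczos_poly (Suc n) s - lanczos_poly n s"

text \<open>The recurrence is the sum formula for
  \<open>cos (\<alpha> + 2\<theta>) + cos (\<alpha> - 2\<theta>)\<close>, with
  \<open>2 cos (2\<theta>) = 4 (cos \<theta>)\<^sup>2 - 2\<close>.\<close>

lemma cos_times_lanczos_poly: "cos \<theta> * lanczos_poly n ((cos \<theta>)\<^sup>2) = cos (real (2 * n + 1) * \<theta>)"
proof (induction n rule: induct_nat_012)
  case 0
  then show ?case by simp
next
  case 1
  have "cos (3 * \<theta>) = 4 * cos \<theta> ^ 3 - 3 * cos \<theta>" by (rule cos_treble_cos)
  then show ?case by (simp add: power2_eq_square power3_eq_cube algebra_simps)
next
  case (ge2 n)
  define \<alpha> where "\<alpha> = real (2 * n + 3) * \<theta>"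
  have "cos (\<alpha> + 2 * \<theta>) + cos (\<alpha> - 2 * \<theta>) = 2 * cos (2 * \<theta>) * cos \<alpha>"
    by (simp add: cos_add cos_diff)
  then have "cos (\<alpha> + 2 * \<theta>) + cos (\<alpha> - 2 * \<theta>) = (4 * (cos \<theta>)\<^sup>2 - 2) * cos \<alpha>"
    by (simp only: cos_double_cos) (simp add: algebra_simps)
  moreover have "\<alpha> + 2 * \<theta> = real (2 * Suc (Suc n) + 1) * \<theta>"
    "\<alpha> - 2 * \<theta> = real (2 * n + 1) * \<theta>" "\<alpha> = real (2 * Suc n + 1) * \<theta>"
    by (simp_all add: \<alpha>_def algebra_simps)
  ultimately have rec: "cos (real (2 * Suc (Suc n) + 1) * \<theta>)
      = (4 * (cos \<theta>)\<^sup>2 - 2) * cos (real (2 * Suc n + 1) * \<theta>) - cos (real (2 * n + 1) * \<theta>)"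
    by simp
  show ?case unfolding rec ge2[symmetric] by (simp add: algebra_simps)
qed

lemma lanczos_poly_bounded:
  assumes "0 \<le> s" "s \<le> 1"
  shows "s * (lanczos_poly n s)\<^sup>2 \<le> 1"
proof -
  define \<theta> where "\<theta> = arccos (sqrt s)"
  have "cos \<theta> = sqrt s"
    unfolding \<theta>_def using assms by (intro cos_arccos) (auto intro: order_trans[of _ 0])
  then have "(cos \<theta>)\<^sup>2 = s" using assms by simp
  then have "s * (lanczos_poly n s)\<^sup>2 = (cos \<theta> * lanczos_poly n ((cos \<theta>)\<^sup>2))\<^sup>2"
    by (simp add: power_mult_distrib)
  also have "\<dots> \<le> 1" unfolding cos_times_lanczos_poly by (simp add: abs_square_le_1)
  finally show ?thesis .
qed

text \<open>Measures the growth at negative arguments: for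
  \<open>s = - (sinh \<psi>)\<^sup>2\<close> the coefficient \<open>4 s - 2\<close> is
  \<open>- 2 cosh (2\<psi>)\<close>, whence the alternating sign.\<close>

lemma sinh_times_lanczos_poly:
  "sinh \<psi> * lanczos_poly n (- (sinh \<psi>)\<^sup>2) = (- 1) ^ n * sinh (real (2 * n + 1) * \<psi>)"
proof (induction n rule: induct_nat_012)
  case 0
  then show ?case by simp
next
  case 1
  have "sinh (2 * \<psi> + \<psi>) = 4 * sinh \<psi> ^ 3 + 3 * sinh \<psi>"
  proof -
    have "sinh (2 * \<psi> + \<psi>) = 2 * sinh \<psi> * (cosh \<psi>)\<^sup>2 + ((cosh \<psi>)\<^sup>2 + (sinh \<psi>)\<^sup>2) * sinh \<psi>"
      unfolding sinh_add sinh_double cosh_double by (simp add: power2_eq_square)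
    then show ?thesis
      unfolding cosh_square_eq by (simp add: power2_eq_square power3_eq_cube algebra_simps)
  qed
  then show ?case by (simp add: power2_eq_square power3_eq_cube algebra_simps)
next
  case (ge2 n)
  define \<alpha> where "\<alpha> = real (2 * n + 3) * \<psi>"
  have "sinh (\<alpha> + 2 * \<psi>) + sinh (\<alpha> - 2 * \<psi>) = 2 * cosh (2 * \<psi>) * sinh \<alpha>"
    by (simp add: sinh_add sinh_diff)
  then have "sinh (\<alpha> + 2 * \<psi>) + sinh (\<alpha> - 2 * \<psi>) = (4 * (sinh \<psi>)\<^sup>2 + 2) * sinh \<alpha>"
    by (simp only: cosh_double cosh_square_eq) (simp add: algebra_simps)
  moreover have "\<alpha> + 2 * \<psi> = real (2 * Suc (Suc n) + 1) * \<psi>"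
    "\<alpha> - 2 * \<psi> = real (2 * n + 1) * \<psi>" "\<alpha> = real (2 * Suc n + 1) * \<psi>"
    by (simp_all add: \<alpha>_def algebra_simps)
  ultimately have rec: "sinh (real (2 * Suc (Suc n) + 1) * \<psi>)
      = (4 * (sinh \<psi>)\<^sup>2 + 2) * sinh (real (2 * Suc n + 1) * \<psi>) - sinh (real (2 * n + 1) * \<psi>)"
    by simp
  have "(- 1) ^ Suc (Suc n) * sinh (real (2 * Suc (Suc n) + 1) * \<psi>)
      = - (4 * (sinh \<psi>)\<^sup>2 + 2) * ((- 1) ^ Suc n * sinh (real (2 * Suc n + 1) * \<psi>))
        - (- 1) ^ n * sinh (real (2 * n + 1) * \<psi>)"
    unfolding rec by (simp add: algebra_simps)
  then show ?case unfolding ge2[symmetric] by (simp add: algebra_simps)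
qed

section \<open>Lanczos polynomials of a matrix applied to a vector\<close>

context symmetric_eigenbasis
begin

text \<open>\<open>z\<close> is the polynomial of \<open>c A + e I\<close> applied to
  \<open>u\<close>; degree \<open>n\<close> needs the Krylov space of order
  \<open>n + 1\<close>.\<close>

lemma krylov_lanczos_poly:
  "\<exists>z\<in>krylov (Suc n) A {u}. \<forall>v\<in>B. z \<bullet> v = lanczos_poly n (c * eigval_of A v + e) * (u \<bullet> v)"
proof (induction n rule: induct_nat_012)
  case 0
  then show ?case using krylov_base[of u "{u}"] by auto
next
  case 1
  have "u \<in> krylov (Suc 0) A {u}" by (simp add: krylov_base)
  then have "A *v u \<in> krylov (Suc (Suc 0)) A {u}" "u \<in> krylov (Suc (Suc 0)) A {u}"
    by (auto intro: krylov_mult krylov_base)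
  then have "(4 * c) *\<^sub>R (A *v u) + (4 * e - 3) *\<^sub>R u \<in> krylov (Suc (Suc 0)) A {u}"
    using subspace_krylov by (intro subspace_add subspace_scale)
  then show ?case
    by (rule bexI[rotated]) (simp add: inner_add_left mult_inner algebra_simps)
next
  case (ge2 n)
  then obtain z y where z: "z \<in> krylov (Suc (Suc n)) A {u}"
      "\<forall>v\<in>B. z \<bullet> v = lanczos_poly (Suc n) (c * eigval_of A v + e) * (u \<bullet> v)"
    and y: "y \<in> krylov (Suc n) A {u}"
      "\<forall>v\<in>B. y \<bullet> v = lanczos_poly n (c * eigval_of A v + e) * (u \<bullet> v)"
    by blast
  have "A *v z \<in> krylov (Suc (Suc (Suc n))) A {u}" using z(1) by (rule krylov_mult)
  moreover have "z \<in> krylov (Suc (Suc (Suc n))) A {u}" "y \<in> krylov (Suc (Suc (Suc n))) A {u}"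
    using z(1) y(1) krylov_mono[of "Suc (Suc n)" "Suc (Suc (Suc n))" "{u}" "{u}"]
      krylov_mono[of "Suc n" "Suc (Suc (Suc n))" "{u}" "{u}"] by auto
  ultimately have "(4 * c) *\<^sub>R (A *v z) + (4 * e - 2) *\<^sub>R z - y \<in> krylov (Suc (Suc (Suc n))) A {u}"
    using subspace_krylov by (intro subspace_diff subspace_add subspace_scale)
  then show ?case
    by (rule bexI[rotated]) (simp add: inner_add_left inner_diff_left mult_inner z(2) y(2) algebra_simps)
qed

text \<open>Up to a positive factor, the excess of \<open>z\<close> over the allowed error is a sum
  over \<open>B\<close>. Each \<open>v\<close> contributes at most
  \<open>(u \<bullet> v)\<^sup>2\<close>, in total at most \<open>1\<close>, while by
  \<open>big\<close> the term of \<open>v0\<close> is at most \<open>-1\<close>.\<close>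

lemma krylov_approx_min_eigenvector:
  assumes v0: "v0 \<in> B" "eigval_of A v0 = lambda_min A" and u: "norm u \<le> 1"
    and k: "0 < \<kappa>" "\<kappa> < 1" and lt: "lambda_min A < lambda_max A"
    and big: "1 \<le> \<bar>u \<bullet> v0\<bar> * sinh (real (2 * n + 1) * artanh \<kappa>)"
  shows "\<exists>z\<in>krylov (Suc n) A {u}. z \<noteq> 0 \<and>
    z \<bullet> (A *v z) - lambda_min A * (norm z)\<^sup>2 \<le> (lambda_max A - lambda_min A) * \<kappa>\<^sup>2 * (norm z)\<^sup>2"
proof -
  define L where "L = lambda_max A - lambda_min A"
  define \<epsilon> where "\<epsilon> = L * \<kappa>\<^sup>2"
  have k2: "\<kappa>\<^sup>2 < 1" using k by (simp add: power_less_one_iff)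
  have L: "L > 0" using lt by (simp add: L_def)
  then have d: "L - \<epsilon> > 0" using k2 by (simp add: \<epsilon>_def)
  define \<psi> where "\<psi> = artanh \<kappa>"
  \<comment> \<open>Sends \<open>lambda_min A + \<epsilon>\<close> to \<open>0\<close> and
    \<open>lambda_max A\<close> to \<open>1\<close>; only eigenvalues within
    \<open>\<epsilon>\<close> of the minimum become negative.\<close>
  define s where "s v = (eigval_of A v - lambda_min A - \<epsilon>) / (L - \<epsilon>)" for v
  have s_eq: "1 / (L - \<epsilon>) * eigval_of A v + (- (lambda_min A + \<epsilon>) / (L - \<epsilon>)) = s v" for v
    by (simp add: s_def diff_divide_distrib add_divide_distrib)
  obtain z where z: "z \<in> krylov (Suc n) A {u}"
    and zv: "\<And>v. v \<in> B \<Longrightarrow> z \<bullet> v = lanczos_poly n (s v) * (u \<bullet> v)"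
    using krylov_lanczos_poly[of n u "1 / (L - \<epsilon>)" "- (lambda_min A + \<epsilon>) / (L - \<epsilon>)"]
    unfolding s_eq by blast
  \<comment> \<open>\<open>\<psi>\<close> is chosen so that \<open>(sinh \<psi>)\<^sup>2 =
    \<kappa>\<^sup>2 / (1 - \<kappa>\<^sup>2)\<close>, which is minus the image of the smallest
    eigenvalue under \<open>s\<close>.\<close>
  have tanh: "tanh \<psi> = \<kappa>"
  proof -
    have "exp (- 2 * \<psi>) = (1 - \<kappa>) / (1 + \<kappa>)"
      using k by (simp add: \<psi>_def artanh_def exp_minus)
    then have "tanh \<psi> = (1 - (1 - \<kappa>) / (1 + \<kappa>)) / (1 + (1 - \<kappa>) / (1 + \<kappa>))"
      unfolding tanh_real_altdef by (simp only:)
    then show ?thesis using k by (simp add: divide_simps)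
  qed
  have "(cosh \<psi>)\<^sup>2 * \<kappa>\<^sup>2 = (sinh \<psi>)\<^sup>2"
    unfolding tanh[symmetric] tanh_def by (simp add: power_divide)
  then have "(sinh \<psi>)\<^sup>2 * (1 - \<kappa>\<^sup>2) = \<kappa>\<^sup>2"
    unfolding cosh_square_eq by (simp add: algebra_simps)
  then have "(sinh \<psi>)\<^sup>2 = \<kappa>\<^sup>2 / (1 - \<kappa>\<^sup>2)" using k2 by (simp add: field_simps)
  also have "\<dots> = \<epsilon> / (L - \<epsilon>)" using L d by (simp add: \<epsilon>_def field_simps)
  finally have s0: "s v0 = - (sinh \<psi>)\<^sup>2" by (simp add: s_def v0)
  have s0W: "s v0 * (lanczos_poly n (s v0))\<^sup>2 = - (sinh (real (2 * n + 1) * \<psi>))\<^sup>2"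
  proof -
    have "s v0 * (lanczos_poly n (s v0))\<^sup>2 = - (sinh \<psi> * lanczos_poly n (- (sinh \<psi>)\<^sup>2))\<^sup>2"
      unfolding s0 by (simp add: power_mult_distrib)
    also have "\<dots> = - (sinh (real (2 * n + 1) * \<psi>))\<^sup>2"
      unfolding sinh_times_lanczos_poly by (simp add: power_mult_distrib flip: power_mult)
    finally show ?thesis .
  qed
  have big2: "1 \<le> (u \<bullet> v0)\<^sup>2 * (sinh (real (2 * n + 1) * \<psi>))\<^sup>2"
    using power_mono[OF big, of 2] by (simp add: \<psi>_def power_mult_distrib)
  then have "lanczos_poly n (s v0) \<noteq> 0" "u \<bullet> v0 \<noteq> 0" using s0W by auto
  then have "z \<noteq> 0" using zv[OF v0(1)] by auto
  have summand: "s v * (lanczos_poly n (s v))\<^sup>2 * (u \<bullet> v)\<^sup>2 \<le> (u \<bullet> v)\<^sup>2" if "v \<in> B" for v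
  proof -
    have "s v \<le> 1" using eigval_of_bounds(2)[OF that] d by (simp add: s_def L_def)
    then have "s v * (lanczos_poly n (s v))\<^sup>2 \<le> 1"
      using lanczos_poly_bounded[of "s v" n] mult_nonpos_nonneg[of "s v" "(lanczos_poly n (s v))\<^sup>2"]
      by (cases "s v \<ge> 0") auto
    from mult_right_mono[OF this, of "(u \<bullet> v)\<^sup>2"] show ?thesis by simp
  qed
  have "z \<bullet> (A *v z) - lambda_min A * (norm z)\<^sup>2 - \<epsilon> * (norm z)\<^sup>2
      = (\<Sum>v\<in>B. (eigval_of A v - lambda_min A - \<epsilon>) * (z \<bullet> v)\<^sup>2)"
    unfolding quadratic_form norm_sq sum_distrib_left
    by (simp add: algebra_simps sum.distrib sum_subtractf)
  also have "\<dots> = (L - \<epsilon>) * (\<Sum>v\<in>B. s v * (lanczos_poly n (s v))\<^sup>2 * (u \<bullet> v)\<^sup>2)"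
    unfolding sum_distrib_left using d
    by (intro sum.cong) (simp_all add: s_def zv power_mult_distrib)
  also have "(\<Sum>v\<in>B. s v * (lanczos_poly n (s v))\<^sup>2 * (u \<bullet> v)\<^sup>2)
      = s v0 * (lanczos_poly n (s v0))\<^sup>2 * (u \<bullet> v0)\<^sup>2
        + (\<Sum>v\<in>B - {v0}. s v * (lanczos_poly n (s v))\<^sup>2 * (u \<bullet> v)\<^sup>2)"
    using fin v0 by (intro sum.remove) auto
  also have "\<dots> \<le> - 1 + (\<Sum>v\<in>B - {v0}. (u \<bullet> v)\<^sup>2)"
    using big2 summand by (intro add_mono sum_mono) (auto simp: s0W mult.commute)
  also have "(\<Sum>v\<in>B - {v0}. (u \<bullet> v)\<^sup>2) \<le> (norm u)\<^sup>2"
    unfolding norm_sq using fin by (intro sum_mono2) auto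
  also have "(norm u)\<^sup>2 \<le> 1" using u by (simp add: abs_square_le_1)
  finally have "z \<bullet> (A *v z) - lambda_min A * (norm z)\<^sup>2 \<le> \<epsilon> * (norm z)\<^sup>2"
    using d by (simp add: mult_nonneg_nonpos)
  with z \<open>z \<noteq> 0\<close> show ?thesis by (auto simp: \<epsilon>_def L_def)
qed

end

section \<open>Numerical estimates for the growth of the polynomial\<close>

lemma artanh_ge:
  fixes x :: real
  assumes "0 \<le> x" "x < 1"
  shows "x \<le> artanh x"
proof -
  have "artanh 0 - 0 \<le> artanh x - x"
  proof (rule DERIV_nonneg_imp_nondecreasing[OF assms(1)])
    fix y assume y: "0 \<le> y" "y \<le> x"
    with assms have "((\<lambda>x. artanh x - x) has_real_derivative 1 / (1 - y\<^sup>2) - 1) (at y)"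
      by (auto intro!: derivative_eq_intros)
    moreover have "y\<^sup>2 < 1" using y assms by (simp add: power_less_one_iff)
    then have "1 / (1 - y\<^sup>2) - 1 \<ge> 0" by (simp add: field_simps)
    ultimately show "\<exists>D. ((\<lambda>x. artanh x - x) has_real_derivative D) (at y) \<and> 0 \<le> D" by blast
  qed
  then show ?thesis by simp
qed

text \<open>With \<open>S = 2 sqrt d / \<delta>\<close> the prefactor is \<open>3/(4 S)\<close> and
  \<open>exp (l/2) = S\<close>. From \<open>artanh x \<ge> x\<close> and
  \<open>(2t - 1)/t \<ge> 3/2\<close> the argument is at least \<open>1.5 m \<ge> 1.1 + l/2\<close>,
  whose \<open>sinh\<close> is at least \<open>4/3 S\<close>.\<close>

lemma sinh_artanh_large:
  fixes d \<delta> t :: real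
  defines "l \<equiv> ln (4 * d / \<delta>\<^sup>2)"
  defines "m \<equiv> sqrt (1 + l\<^sup>2 / 4)"
  assumes d: "d \<ge> 1" and delta: "0 < \<delta>" "\<delta> < 1" and t: "t \<ge> 2" and mt: "m < t"
  shows "1 \<le> 3 * \<delta> / (8 * sqrt d) * sinh ((2 * t - 1) * artanh (m / t))"
proof -
  define S where "S = 2 * sqrt d / \<delta>"
  have m0: "m \<ge> 1" by (simp add: m_def)
  have "sqrt d \<ge> 1" using d by simp
  with delta have "\<delta> \<le> sqrt d" by linarith
  then have S: "S \<ge> 2" using delta by (simp add: S_def field_simps)
  have S2: "4 * d / \<delta>\<^sup>2 = S\<^sup>2" using d by (simp add: S_def power_divide power_mult_distrib)
  have expl: "exp (l / 2) = S"
    using S by (simp add: l_def S2 ln_realpow)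
  have l: "l \<ge> 0" unfolding l_def S2 using S by (simp add: power2_eq_square mult_ge1_I)
  have "1.1 + l / 2 \<le> 1.5 * m"
  proof -
    have "(1.1 + l / 2)\<^sup>2 \<le> (1.5)\<^sup>2 * (1 + l\<^sup>2 / 4)"
    proof -
      \<comment> \<open>The required difference is \<open>0.3125 l\<^sup>2 - 1.1 l + 1.04\<close>, a
        parabola with vertex \<open>1.76\<close> and positive minimum.\<close>
      have "0 \<le> (l - 1.76)\<^sup>2" by simp
      then have "1.1 * l \<le> 0.3125 * l\<^sup>2 + 0.968" by (simp add: power2_eq_square algebra_simps)
      then show ?thesis by (simp add: power2_eq_square algebra_simps)
    qed
    from real_le_rsqrt[OF this] show ?thesis
      by (simp add: m_def real_sqrt_mult)
  qed
  also have "1.5 * m \<le> (2 * t - 1) * (m / t)"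
    using t m0 by (simp add: field_simps mult_left_mono)
  also have "\<dots> \<le> (2 * t - 1) * artanh (m / t)"
    using t m0 mt by (intro mult_left_mono artanh_ge) auto
  finally have X: "1.1 + l / 2 \<le> (2 * t - 1) * artanh (m / t)" .
  \<comment> \<open>The bound \<open>2.8\<close> suffices because
    \<open>(2.8 S - 1/5.6)/2 \<ge> 4/3 S\<close> for \<open>S \<ge> 2\<close>.\<close>
  define a :: real where "a = exp 1.1"
  have a: "a \<ge> 2.8"
  proof -
    have "(2.8 :: real) \<le> (1 + 0.55 + 0.55\<^sup>2 / 2)\<^sup>2" by (simp add: power2_eq_square)
    also have "\<dots> \<le> (exp 0.55)\<^sup>2"
      by (intro power_mono exp_lower_Taylor_quadratic) auto
    also have "\<dots> = a" by (simp add: a_def flip: exp_double)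
    finally show ?thesis .
  qed
  have "4 / 3 * S \<le> (a * S - 1 / (a * S)) / 2"
  proof -
    define p q where "p = a * S" and "q = 1 / (a * S)"
    have "2.8 * S \<le> p" unfolding p_def using a S by (intro mult_right_mono) auto
    moreover have "q \<le> 1 / (2.8 * 2)"
      unfolding q_def using a S by (intro divide_left_mono mult_mono) auto
    ultimately have "4 / 3 * S \<le> (p - q) / 2" using S by simp
    then show ?thesis unfolding p_def q_def .
  qed
  also have "\<dots> = sinh (1.1 + l / 2)"
    by (simp add: sinh_def exp_add expl a_def exp_minus inverse_eq_divide exp_diff)
  also have "\<dots> \<le> sinh ((2 * t - 1) * artanh (m / t))" using X by simp
  finally have "4 / 3 * S \<le> sinh ((2 * t - 1) * artanh (m / t))" .
  from mult_left_mono[OF this, of "3 * \<delta> / (8 * sqrt d)"] show ?thesis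
    using delta d by (simp add: S_def field_simps)
qed

context symmetric_eigenbasis
begin

text \<open>Take \<open>\<kappa> = m / t\<close>, for which \<open>L \<kappa>\<^sup>2\<close> is the
  claimed error, and normalise the resulting vector.\<close>

lemma krylov_approx_min_eigenvector_explicit:
  fixes \<delta> d :: real
  assumes v0: "v0 \<in> B" "eigval_of A v0 = lambda_min A" and u: "norm u \<le> 1"
    and delta: "0 < \<delta>" "\<delta> < 1" and d: "d \<ge> 1"
    and big: "3 * \<delta> / (8 * sqrt d) \<le> \<bar>u \<bullet> v0\<bar>" and t: "t \<ge> 1"
  shows "\<exists>z\<in>krylov t A {u}. norm z = 1 \<and> z \<bullet> (A *v z) - lambda_min A
    \<le> (lambda_max A - lambda_min A) * (1 + (ln (4 * d / \<delta>\<^sup>2))\<^sup>2 / 4) / (real t)\<^sup>2"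
proof -
  define L where "L = lambda_max A - lambda_min A"
  define m where "m = sqrt (1 + (ln (4 * d / \<delta>\<^sup>2))\<^sup>2 / 4)"
  have m2: "m\<^sup>2 = 1 + (ln (4 * d / \<delta>\<^sup>2))\<^sup>2 / 4" and m1: "m \<ge> 1" by (simp_all add: m_def)
  have L: "L \<ge> 0" using eigval_of_bounds[OF v0(1)] by (simp add: L_def)
  have "\<exists>z\<in>krylov t A {u}. z \<noteq> 0 \<and>
    z \<bullet> (A *v z) - lambda_min A * (norm z)\<^sup>2 \<le> L * (m / real t)\<^sup>2 * (norm z)\<^sup>2"
  \<comment> \<open>If \<open>\<kappa> \<ge> 1\<close> or the spectrum is a single point,
    \<open>u\<close> itself works, its excess being at most
    \<open>L \<parallel>u\<parallel>\<^sup>2\<close>.\<close>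
  proof (cases "real t \<le> m \<or> L = 0")
    case True
    have "3 * \<delta> / (8 * sqrt d) > 0" using delta d by simp
    then have "u \<noteq> 0" using big by auto
    moreover have "u \<in> krylov t A {u}" using krylov_base[of u "{u}" "t - 1"] t by simp
    moreover have "u \<bullet> (A *v u) - lambda_min A * (norm u)\<^sup>2 \<le> L * (norm u)\<^sup>2"
      using quadratic_form_bounds(2)[of u] by (simp add: L_def algebra_simps)
    moreover have "L * (norm u)\<^sup>2 \<le> L * (m / real t)\<^sup>2 * (norm u)\<^sup>2"
    proof (cases "L = 0")
      case False
      then have "1 \<le> m / real t" using True t by simp
      then have "1 \<le> (m / real t)\<^sup>2" by (simp add: one_le_power)
      then have "L * 1 \<le> L * (m / real t)\<^sup>2" using L by (intro mult_left_mono)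
      then show ?thesis by (intro mult_right_mono) auto
    qed simp
    ultimately show ?thesis by (meson order_trans)
  next
    case False
    then have mt: "m < real t" and L0: "L \<noteq> 0" by auto
    then have t2: "real t \<ge> 2" using m1 by simp
    have "1 \<le> 3 * \<delta> / (8 * sqrt d) * sinh ((2 * real t - 1) * artanh (m / real t))"
      unfolding m_def using mt by (intro sinh_artanh_large d delta t2) (simp add: m_def)
    also have "\<dots> \<le> \<bar>u \<bullet> v0\<bar> * sinh ((2 * real t - 1) * artanh (m / real t))"
    proof (intro mult_right_mono big)
      have "m / real t \<le> artanh (m / real t)" using mt m1 by (intro artanh_ge) auto
      moreover have "m / real t \<ge> 0" using m1 by simp
      ultimately show "0 \<le> sinh ((2 * real t - 1) * artanh (m / real t))" using t2 by simp
    qed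
    \<comment> \<open>Order \<open>t\<close> allows degree \<open>t - 1\<close>, and
      \<open>2 (t - 1) + 1\<close> is the frequency in
      \<open>sinh_times_lanczos_poly\<close>.\<close>
    also have "2 * real t - 1 = real (2 * (t - 1) + 1)" using t by (simp add: of_nat_diff)
    finally have "\<exists>z\<in>krylov (Suc (t - 1)) A {u}. z \<noteq> 0 \<and> z \<bullet> (A *v z) - lambda_min A * (norm z)\<^sup>2
        \<le> (lambda_max A - lambda_min A) * (m / real t)\<^sup>2 * (norm z)\<^sup>2"
      using mt m1 L0 L by (intro krylov_approx_min_eigenvector[OF v0 u]) (auto simp: L_def)
    then show ?thesis using t by (simp add: L_def)
  qed
  then obtain z where z: "z \<in> krylov t A {u}" "z \<noteq> 0"
      "z \<bullet> (A *v z) - lambda_min A * (norm z)\<^sup>2 \<le> L * (m / real t)\<^sup>2 * (norm z)\<^sup>2" by blast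
  define y where "y = (1 / norm z) *\<^sub>R z"
  have "y \<in> krylov t A {u}" unfolding y_def using z(1) subspace_krylov by (intro subspace_scale)
  moreover have "norm y = 1" using z(2) by (simp add: y_def)
  moreover have "y \<bullet> (A *v y) - lambda_min A \<le> L * (m / real t)\<^sup>2"
  proof -
    have "y \<bullet> (A *v y) = (z \<bullet> (A *v z)) / (norm z)\<^sup>2"
      by (simp add: y_def matrix_vector_mult_scaleR power2_eq_square)
    moreover have "z \<bullet> (A *v z) \<le> (lambda_min A + L * (m / real t)\<^sup>2) * (norm z)\<^sup>2"
      using z(3) by (simp add: algebra_simps)
    ultimately have "y \<bullet> (A *v y) \<le> lambda_min A + L * (m / real t)\<^sup>2"
      using z(2) by (simp add: pos_divide_le_eq)
    then show ?thesis by simp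
  qed
  ultimately show ?thesis by (auto simp: L_def power_divide m2)
qed

end

section \<open>Near minimisers on a ball\<close>

text \<open>A line through a point of the ball meets the sphere in both directions, so the sign of
  \<open>c\<close> is free; a chord has length at most \<open>2 R\<close>.\<close>

lemma scaled_to_sphere:
  fixes x z g :: "'a::real_inner"
  assumes x: "norm x \<le> R" and z: "norm z = 1"
  shows "\<exists>c. norm (x + c *\<^sub>R z) = R \<and> c * (z \<bullet> g) \<le> 0 \<and> c\<^sup>2 \<le> 4 * R\<^sup>2"
proof -
  have R: "R \<ge> 0" using x norm_ge_zero order_trans by blast
  have pos: "\<exists>c\<ge>0. norm (x + c *\<^sub>R y) = R" if y: "norm y = 1" for y :: 'a
  proof -
    define p where "p = x \<bullet> y"
    \<comment> \<open>\<open>q - p\<close> is the nonnegative root \<open>c\<close> of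
      \<open>\<parallel>x + c y\<parallel>\<^sup>2 = R\<^sup>2\<close>.\<close>
    define q where "q = sqrt (p\<^sup>2 + R\<^sup>2 - (norm x)\<^sup>2)"
    have x2: "(norm x)\<^sup>2 \<le> R\<^sup>2" using x by (simp add: power_mono)
    moreover have "0 \<le> p\<^sup>2" by simp
    ultimately have "0 \<le> p\<^sup>2 + R\<^sup>2 - (norm x)\<^sup>2" by linarith
    then have q2: "q\<^sup>2 = p\<^sup>2 + R\<^sup>2 - (norm x)\<^sup>2" by (simp add: q_def)
    have "p \<le> q" unfolding q_def using x2 by (intro real_le_rsqrt) simp
    have yy: "y \<bullet> y = 1" using y by (simp add: norm_eq_1)
    have "(norm (x + (q - p) *\<^sub>R y))\<^sup>2 = (norm x)\<^sup>2 + 2 * (q - p) * p + (q - p)\<^sup>2"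
      unfolding power2_norm_eq_inner
      by (simp add: inner_add_left inner_add_right inner_commute[of y x] yy p_def[symmetric])
        (simp add: power2_eq_square algebra_simps)
    also have "\<dots> = (norm x)\<^sup>2 + q\<^sup>2 - p\<^sup>2" by (simp add: power2_eq_square algebra_simps)
    also have "\<dots> = R\<^sup>2" by (simp add: q2)
    finally have "norm (x + (q - p) *\<^sub>R y) = R" using R by simp
    with \<open>p \<le> q\<close> show ?thesis by (intro exI[of _ "q - p"]) simp
  qed
  obtain c where c: "norm (x + c *\<^sub>R z) = R" "c * (z \<bullet> g) \<le> 0"
  proof (cases "z \<bullet> g \<le> 0")
    case True
    with pos[OF z] that show ?thesis by (metis mult_nonneg_nonpos)
  next
    case False
    obtain c where "c \<ge> 0" "norm (x + c *\<^sub>R (- z)) = R" using pos[of "- z"] z by auto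
    with that[of "- c"] False show ?thesis by (simp add: mult_nonneg_nonneg)
  qed
  have "\<bar>c\<bar> = norm ((x + c *\<^sub>R z) - x)" using z by simp
  also have "\<dots> \<le> 2 * R" using norm_triangle_ineq4[of "x + c *\<^sub>R z" x] c(1) x by simp
  finally have "\<bar>c\<bar>\<^sup>2 \<le> (2 * R)\<^sup>2" by (intro power_mono) auto
  with c show ?thesis by (auto simp: power_mult_distrib)
qed

text \<open>If the smallest eigenvalue \<open>l\<close> is negative, \<open>f - l/2 (\<parallel>\<cdot>\<parallel>\<^sup>2 - R\<^sup>2)\<close> is a convex lower bound of \<open>f\<close> on
  the ball of radius \<open>R\<close> which agrees with \<open>f\<close> on the sphere.\<close>

context symmetric_eigenbasis
begin

lemma krylov_near_minimizer:
  fixes b u w :: "real^'n" and R \<delta> d :: real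
  assumes v0: "v0 \<in> B" "eigval_of A v0 = lambda_min A" and u: "norm u \<le> 1"
    and delta: "0 < \<delta>" "\<delta> < 1" and d: "d \<ge> 1"
    and big: "3 * \<delta> / (8 * sqrt d) \<le> \<bar>u \<bullet> v0\<bar>" and t: "t \<ge> 1" and w: "norm w \<le> R"
  shows "\<exists>x\<in>krylov t A {b, u}. norm x \<le> R \<and> quad_obj A b x - quad_obj A b w
    \<le> (lambda_max A - lambda_min A) * R\<^sup>2 / (real t)\<^sup>2
       * (4 + of_bool (lambda_min A < 0) / 2 * (ln (4 * d / \<delta>\<^sup>2))\<^sup>2)"
proof -
  define L where "L = lambda_max A - lambda_min A"
  define l where "l = lambda_min A"
  \<comment> \<open>For \<open>l \<ge> 0\<close> the two corrections in \<open>F\<close> cancel and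
    \<open>F\<close> is the objective; for \<open>l < 0\<close> it is the convexified
    objective.\<close>
  define \<mu> where "\<mu> = max l 0"
  define F where "F x = quad_obj A b x - l/2 * (norm x)\<^sup>2 + \<mu>/2 * (norm x)\<^sup>2" for x
  have L: "L \<ge> 0" using eigval_of_bounds[OF v0(1)] by (simp add: L_def)
  have R: "R \<ge> 0" using w norm_ge_zero order_trans by blast
  define T where "T = R\<^sup>2 / (real t)\<^sup>2"
  define q where "q = (ln (4 * d / \<delta>\<^sup>2))\<^sup>2"
  obtain x where x: "x \<in> krylov t A {b}" "norm x \<le> R" and Fx: "F x - F w \<le> 2 * L * T"
  proof -
    obtain x z where x: "x \<in> krylov t A {b}" "norm x \<le> R"
      and acc: "real t * (real t + 1) / 4 * (F x - F w) + L/2 * (norm (w - z))\<^sup>2 \<le> L/2 * (norm w)\<^sup>2"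
      using krylov_accelerated_gradient[OF sym, of l L \<mu> R t b] quadratic_form_bounds L R w
      unfolding F_def by (auto simp: l_def L_def \<mu>_def)
    have "L/2 * (norm w)\<^sup>2 \<le> L/2 * R\<^sup>2" using w L by (intro mult_left_mono power_mono) auto
    moreover have "0 \<le> L/2 * (norm (w - z))\<^sup>2" using L by simp
    ultimately have bd: "real t * (real t + 1) / 4 * (F x - F w) \<le> L/2 * R\<^sup>2" using acc by linarith
    have "F x - F w \<le> 2 * L * T"
    \<comment> \<open>Replacing \<open>t (t + 1)\<close> by \<open>t\<^sup>2\<close> needs a
      nonnegative gap.\<close>
    proof (cases "F x - F w \<le> 0")
      case True
      moreover have "0 \<le> 2 * L * T" using L by (simp add: T_def)
      ultimately show ?thesis by linarith
    next
      case False
      then have "(real t)\<^sup>2 / 4 * (F x - F w) \<le> real t * (real t + 1) / 4 * (F x - F w)"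
        by (intro mult_right_mono) (auto simp: power2_eq_square distrib_left)
      with bd have "(real t)\<^sup>2 / 4 * (F x - F w) \<le> L/2 * R\<^sup>2" by linarith
      then show ?thesis using t by (simp add: T_def field_simps)
    qed
    with x that show ?thesis by blast
  qed
  have "\<exists>x\<in>krylov t A {b, u}. norm x \<le> R \<and> quad_obj A b x - quad_obj A b w
    \<le> L * T * (4 + of_bool (l < 0) / 2 * q)"
  proof (cases "l < 0")
    case False
    then have "F = quad_obj A b" by (auto simp: F_def \<mu>_def)
    moreover have "0 \<le> L * T" using L by (simp add: T_def)
    ultimately have "quad_obj A b x - quad_obj A b w \<le> L * T * (4 + of_bool (l < 0) / 2 * q)"
      using Fx False by simp
    with x krylov_mono[of t t "{b}" "{b, u}" A] show ?thesis by auto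
  next
    case True
    then have F: "F y = quad_obj A b y - l/2 * (norm y)\<^sup>2" for y by (simp add: F_def \<mu>_def)
    obtain z where z: "z \<in> krylov t A {u}" "norm z = 1"
        "z \<bullet> (A *v z) - l \<le> L * (1 + q / 4) / (real t)\<^sup>2"
      using krylov_approx_min_eigenvector_explicit[OF v0 u delta d big t] unfolding l_def L_def q_def
      by blast
    define g where "g = A *v x - l *\<^sub>R x + b"
    obtain c where c: "norm (x + c *\<^sub>R z) = R" "c * (z \<bullet> g) \<le> 0" "c\<^sup>2 \<le> 4 * R\<^sup>2"
      using scaled_to_sphere[OF x(2) z(2)] by blast
    define y where "y = x + c *\<^sub>R z"
    have "x \<bullet> (A *v z) = (A *v x) \<bullet> z" by (rule inner_matrix_symmetric[OF sym])
    moreover have "z \<bullet> z = 1" using z(2) by (simp add: norm_eq_1)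
    ultimately have "F y = F x + c * (z \<bullet> g) + c\<^sup>2 / 2 * (z \<bullet> (A *v z) - l)"
      unfolding F y_def quad_obj_def g_def power2_norm_eq_inner
      by (simp add: matrix_vector_right_distrib matrix_vector_mult_scaleR inner_diff_left
          inner_diff_right inner_add_left inner_add_right inner_commute power2_eq_square field_simps)
    \<comment> \<open>This costs \<open>L T (2 + q/2)\<close>; together with the accelerated error
      \<open>2 L T\<close> it produces the factor \<open>4 + q/2\<close>.\<close>
    moreover have "c\<^sup>2 / 2 * (z \<bullet> (A *v z) - l) \<le> 4 * R\<^sup>2 / 2 * (L * (1 + q / 4) / (real t)\<^sup>2)"
      using z(2,3) c(3) quadratic_form_bounds(1)[of z] by (intro mult_mono) (auto simp: l_def)
    moreover have "\<dots> = L * T * (2 + q / 2)"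
      by (simp add: T_def add_divide_distrib algebra_simps)
    moreover have "quad_obj A b y = F y + l/2 * R\<^sup>2" using c(1) by (simp add: F y_def)
    moreover have "F w + l/2 * R\<^sup>2 \<le> quad_obj A b w"
    proof -
      have "(norm w)\<^sup>2 \<le> R\<^sup>2" using w by (simp add: power_mono)
      then have "l/2 * R\<^sup>2 \<le> l/2 * (norm w)\<^sup>2" using True by (intro mult_left_mono_neg) auto
      then show ?thesis by (simp add: F)
    qed
    moreover have "2 * L * T + L * T * (2 + q / 2) = L * T * (4 + q / 2)" by (simp add: algebra_simps)
    ultimately have "quad_obj A b y - quad_obj A b w \<le> L * T * (4 + q / 2)"
      using Fx c(2) by linarith
    moreover have "y \<in> krylov t A {b, u}"
      unfolding y_def using x(1) z(1) krylov_mono[of t t "{b}" "{b, u}" A]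
        krylov_mono[of t t "{u}" "{b, u}" A] subspace_krylov
      by (intro subspace_add subspace_scale) auto
    moreover have "norm y \<le> R" using c(1) by (simp add: y_def)
    ultimately show ?thesis using True by auto
  qed
  then show ?thesis by (simp add: L_def T_def l_def q_def)
qed

end

section \<open>Anticoncentration on the sphere\<close>

text \<open>The translates of the slab by multiples of \<open>2s v\<close> are disjoint, and the points of the slab are
  nearly orthogonal to \<open>v\<close>, so \<open>2K+1\<close> of them fit into a ball only slightly larger than the unit ball.\<close>

lemma measure_ball_slab_le:
  fixes v :: "'a::euclidean_space" and s :: real and K :: nat
  assumes v: "norm v = 1" and s: "s > 0"
  defines "S \<equiv> {x \<in> ball 0 1. \<bar>x \<bullet> v\<bar> < s}"
  shows "(2 * real K + 1) * measure lebesgue S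
    \<le> exp (2 * DIM('a) * s\<^sup>2 * real K * (real K + 1)) * measure lebesgue (ball (0::'a) 1)"
proof -
  \<comment> \<open>The exponential form comes from \<open>1 + y \<le> exp y\<close> and makes the
    \<open>DIM('a)\<close>-th power explicit in the volume.\<close>
  define \<rho> where "\<rho> = exp (2 * s\<^sup>2 * real K * (real K + 1))"
  define T where "T k = (+) ((2 * s * real_of_int k) *\<^sub>R v) ` S" for k
  have vv: "v \<bullet> v = 1" using v by (simp add: norm_eq_1)
  have "open S"
  proof -
    have "S = ball 0 1 \<inter> {x. \<bar>x \<bullet> v\<bar> < s}" by (auto simp: S_def)
    then show ?thesis by (auto intro!: open_Int open_Collect_less continuous_intros)
  qed
  moreover have "bounded S" by (rule bounded_subset[OF bounded_ball[of 0 1]]) (auto simp: S_def)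
  ultimately have S: "S \<in> lmeasurable" by (intro lmeasurable_open)
  have inner_T: "\<bar>x \<bullet> v - 2 * s * real_of_int k\<bar> < s" if "x \<in> T k" for x k
    using that by (auto simp: T_def S_def inner_add_left vv)
  have disj: "pairwise (\<lambda>i j. disjnt (T i) (T j)) {- int K..int K}"
  proof (intro pairwiseI)
    fix i j :: int assume "i \<noteq> j"
    show "disjnt (T i) (T j)"
    proof (rule ccontr)
      assume "\<not> disjnt (T i) (T j)"
      then obtain x where "x \<in> T i" "x \<in> T j" by (auto simp: disjnt_iff)
      from inner_T[OF this(1)] inner_T[OF this(2)]
      have "2 * s * \<bar>real_of_int (i - j)\<bar> < 2 * s"
        using s by (simp add: abs_mult_pos' flip: abs_mult) (simp add: algebra_simps abs_if split: if_splits)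
      moreover have "1 \<le> \<bar>real_of_int (i - j)\<bar>" using \<open>i \<noteq> j\<close> by linarith
      ultimately show False using s by simp
    qed
  qed
  have sub: "T k \<subseteq> ball 0 \<rho>" if k: "k \<in> {- int K..int K}" for k
  proof
    fix y assume "y \<in> T k"
    then obtain x where x: "norm x < 1" "\<bar>x \<bullet> v\<bar> < s" and y: "y = (2 * s * real_of_int k) *\<^sub>R v + x"
      by (auto simp: T_def S_def)
    have kK: "\<bar>real_of_int k\<bar> \<le> real K" using k by (auto simp: abs_le_iff)
    \<comment> \<open>Since \<open>\<bar>x \<bullet> v\<bar> < s\<close>, the cross term is at most
      \<open>4 s\<^sup>2 K\<close>, so the growth is of second order in \<open>s\<close>.\<close>
    have "(norm y)\<^sup>2 = (norm x)\<^sup>2 + 4 * s * (real_of_int k * (x \<bullet> v)) + 4 * s\<^sup>2 * (real_of_int k)\<^sup>2"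
      unfolding y power2_norm_eq_inner
      by (simp add: inner_add_left inner_add_right vv inner_commute power2_eq_square algebra_simps)
    also have "(norm x)\<^sup>2 < 1" using x by (simp add: power_less_one_iff)
    also have "real_of_int k * (x \<bullet> v) \<le> real K * s"
    proof -
      have "real_of_int k * (x \<bullet> v) \<le> \<bar>real_of_int k\<bar> * \<bar>x \<bullet> v\<bar>" by (simp flip: abs_mult)
      also have "\<dots> \<le> real K * s" using kK x by (intro mult_mono) auto
      finally show ?thesis .
    qed
    also have "(real_of_int k)\<^sup>2 \<le> (real K)\<^sup>2" using kK abs_le_square_iff by fastforce
    also have "1 + 4 * s * (real K * s) + 4 * s\<^sup>2 * (real K)\<^sup>2 = 1 + 4 * s\<^sup>2 * real K * (real K + 1)"
      by (simp add: power2_eq_square algebra_simps)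
    also have "\<dots> \<le> exp (4 * s\<^sup>2 * real K * (real K + 1))" by (rule exp_ge_add_one_self)
    also have "\<dots> = \<rho>\<^sup>2" by (simp add: \<rho>_def flip: exp_double)
    finally have "norm y < \<rho>"
      using s by (simp add: power_less_imp_less_base \<rho>_def)
    then show "y \<in> ball 0 \<rho>" by simp
  qed
  have meas: "T k \<in> lmeasurable" for k unfolding T_def using S by (rule measurable_translation)
  have "(2 * real K + 1) * measure lebesgue S = (\<Sum>k\<in>{- int K..int K}. measure lebesgue (T k))"
    by (simp add: T_def measure_translation)
  also have "\<dots> = measure lebesgue (\<Union>k\<in>{- int K..int K}. T k)"
    using meas disj by (intro measure_UNION'[symmetric]) auto
  also have "\<dots> \<le> measure lebesgue (ball (0::'a) \<rho>)"
  proof (intro measure_mono_fmeasurable)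
    show "(\<Union>k\<in>{- int K..int K}. T k) \<subseteq> ball 0 \<rho>" using sub by blast
  qed (use meas in \<open>auto intro!: sets.finite_UN\<close>)
  also have "\<dots> = \<rho> ^ DIM('a) * measure lebesgue (ball (0::'a) 1)"
    by (simp add: content_ball \<rho>_def)
  also have "\<rho> ^ DIM('a) = exp (2 * DIM('a) * s\<^sup>2 * real K * (real K + 1))"
    by (simp add: \<rho>_def exp_of_nat_mult[symmetric] mult_ac)
  finally show ?thesis .
qed

text \<open>Packing with \<open>K\<close> the integer part of \<open>1/\<delta>\<close>: the growth
  factor of the ball is then at most \<open>(2 K + 1) \<delta>\<close>.\<close>

lemma measure_ball_thin_slab_le:
  fixes v :: "'a::euclidean_space"
  assumes v: "norm v = 1" and delta: "0 < \<delta>" "\<delta> < 1"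
  shows "measure lebesgue {x \<in> ball 0 1. \<bar>x \<bullet> v\<bar> < 3 * \<delta> / (8 * sqrt DIM('a))}
    \<le> \<delta> * measure lebesgue (ball (0::'a) 1)"
proof -
  define s where "s = 3 * \<delta> / (8 * sqrt DIM('a))"
  define S where "S = {x \<in> ball (0::'a) 1. \<bar>x \<bullet> v\<bar> < s}"
  define K where "K = nat \<lfloor>1 / \<delta>\<rfloor>"
  define V where "V = measure lebesgue (ball (0::'a) 1)"
  have s: "s > 0" using delta by (simp add: s_def)
  have "1 / \<delta> \<ge> 1" using delta by simp
  then have "1 \<le> \<lfloor>1 / \<delta>\<rfloor>" by (simp only: le_floor_iff of_int_1)
  moreover from this have "real K = of_int \<lfloor>1 / \<delta>\<rfloor>" by (simp add: K_def del: one_le_floor)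
  ultimately have K: "real K \<le> 1 / \<delta>" "1 / \<delta> < real K + 1" "real K \<ge> 1"
    by linarith+
  \<comment> \<open>As \<open>2 DIM('a) s\<^sup>2 = 9/32 \<delta>\<^sup>2\<close>, the exponent is
    \<open>9/32 p q\<close> with \<open>p \<le> 1 \<le> q \<le> 2 p\<close>, and a quadratic bound
    on \<open>exp\<close> gives at most \<open>p + q\<close>.\<close>
  define p q where "p = \<delta> * real K" and "q = \<delta> * (real K + 1)"
  have p1: "p \<le> 1" using K(1) delta by (simp add: p_def field_simps)
  have q1: "q \<ge> 1" using K(2) delta by (simp add: q_def field_simps)
  have qp: "q \<le> 2 * p" using K(3) delta by (simp add: p_def q_def)
  have "2 * DIM('a) * s\<^sup>2 * real K * (real K + 1) = 9/32 * (p * q)"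
    by (simp add: s_def p_def q_def power_divide power_mult_distrib) (simp add: power2_eq_square)
  also have "\<dots> \<le> 9/32 * q" using p1 q1 by simp
  finally have "exp (2 * DIM('a) * s\<^sup>2 * real K * (real K + 1)) \<le> exp (9/32 * q)" by simp
  also have "\<dots> \<le> 1 + 9/32 * q + (9/32 * q)\<^sup>2"
    using p1 q1 qp by (intro exp_bound) auto
  also have "\<dots> \<le> 1 + 9/32 * q + 81/1024 * (2 * q)"
  proof -
    have "q * q \<le> 2 * q" using p1 q1 qp by (intro mult_right_mono) auto
    then show ?thesis by (simp add: power2_eq_square)
  qed
  also have "\<dots> \<le> p + q" using q1 qp by simp
  also have "\<dots> = (2 * real K + 1) * \<delta>" by (simp add: p_def q_def algebra_simps)
  finally have "exp (2 * DIM('a) * s\<^sup>2 * real K * (real K + 1)) * V \<le> (2 * real K + 1) * \<delta> * V"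
    by (intro mult_right_mono) (auto simp: V_def)
  with measure_ball_slab_le[OF v s, of K]
  have "(2 * real K + 1) * measure lebesgue S \<le> (2 * real K + 1) * (\<delta> * V)"
    unfolding S_def V_def mult.assoc[symmetric] by (rule order_trans)
  then have "measure lebesgue S \<le> \<delta> * V"
    by (subst (asm) mult_le_cancel_left_pos) auto
  then show ?thesis by (simp add: S_def V_def s_def)
qed

text \<open>Bad directions pull back into the thin slab, since \<open>\<bar>x \<bullet> v\<bar>
  \<le> \<bar>sgn x \<bullet> v\<bar>\<close> on the unit ball.\<close>

lemma uniform_sphere_anticoncentration:
  fixes v :: "'a::euclidean_space"
  assumes v: "norm v = 1" and delta: "0 < \<delta>" "\<delta> < 1"
  shows "1 - \<delta> \<le> measure uniform_sphere {u. norm u \<le> 1 \<and> 3 * \<delta> / (8 * sqrt DIM('a)) \<le> \<bar>u \<bullet> v\<bar>}"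
proof -
  interpret prob_space "uniform_sphere :: 'a measure" by (rule prob_space_uniform_sphere)
  define s where "s = 3 * \<delta> / (8 * sqrt DIM('a))"
  define G where "G = {u::'a. norm u \<le> 1 \<and> s \<le> \<bar>u \<bullet> v\<bar>}"
  define S where "S = {x \<in> ball (0::'a) 1. \<bar>x \<bullet> v\<bar> < s}"
  have "closed G" unfolding G_def
    by (intro closed_Collect_conj closed_Collect_le continuous_intros)
  then have G: "G \<in> sets borel" by simp
  then have G': "sgn -` (- G) \<in> sets (borel :: 'a measure)"
    using measurable_sets[OF borel_measurable_sgn_euclidean, of "- G"] by auto
  have SB: "S \<in> sets lborel"
  proof -
    have "S = ball 0 1 \<inter> {x. \<bar>x \<bullet> v\<bar> < s}" by (auto simp: S_def)
    then have "open S" by (auto intro!: open_Int open_Collect_less continuous_intros)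
    then show ?thesis by simp
  qed
  have Sf: "S \<in> fmeasurable lborel"
  proof (intro fmeasurableI SB emeasure_bounded_finite)
    show "bounded S" by (rule bounded_subset[OF bounded_ball[of 0 1]]) (auto simp: S_def)
  qed
  have sub: "ball 0 1 \<inter> sgn -` (- G) \<subseteq> S"
  proof
    fix x :: 'a assume x: "x \<in> ball 0 1 \<inter> sgn -` (- G)"
    have "norm (sgn x) \<le> 1" by (simp add: norm_sgn)
    with x have "\<bar>sgn x \<bullet> v\<bar> < s" by (auto simp: G_def)
    have "\<bar>x \<bullet> v\<bar> = norm x * \<bar>sgn x \<bullet> v\<bar>"
      by (cases "x = 0") (simp_all add: sgn_div_norm abs_mult)
    also have "\<dots> \<le> 1 * \<bar>sgn x \<bullet> v\<bar>" using x by (intro mult_right_mono) auto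
    also have "\<dots> < s" using \<open>\<bar>sgn x \<bullet> v\<bar> < s\<close> by simp
    finally show "x \<in> S" using x by (simp add: S_def)
  qed
  have pos: "measure lborel (ball (0::'a) 1) > 0" by (simp add: content_ball_gt_0_iff)
  have "measure uniform_sphere (- G) = measure (uniform_measure lborel (ball (0::'a) 1)) (sgn -` (- G))"
    unfolding uniform_sphere_def using G by (subst measure_distr) auto
  also have "\<dots> = measure lborel (ball 0 1 \<inter> sgn -` (- G)) / measure lborel (ball (0::'a) 1)"
    using emeasure_lborel_unit_ball[where 'a='a] G' by (subst measure_uniform_measure) auto
  also have "\<dots> \<le> measure lborel S / measure lborel (ball (0::'a) 1)"
    using sub Sf G' by (intro divide_right_mono measure_mono_fmeasurable) auto
  also have "\<dots> \<le> \<delta>"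
    using measure_ball_thin_slab_le[OF v delta] pos SB
    by (simp add: S_def s_def pos_divide_le_eq)
  finally have "measure uniform_sphere (- G) \<le> \<delta>" .
  moreover have "measure uniform_sphere (- G) = 1 - measure uniform_sphere G"
    using prob_compl[of G] G by (simp add: Compl_eq_Diff_UNIV)
  ultimately show ?thesis by (simp add: G_def s_def)
qed

section \<open>Measurability of Krylov conditions\<close>

text \<open>The minimisers \<open>xhat\<close> need not depend measurably on \<open>u\<close>, but their values do: a sublevel condition
  is the projection of a \<open>\<sigma>\<close>-compact set.\<close>

definition sigma_compact :: "'a::topological_space set \<Rightarrow> bool" where
  "sigma_compact S \<longleftrightarrow> (\<exists>F. countable F \<and> (\<forall>K\<in>F. compact K) \<and> S = \<Union>F)"

section \<open>Closure properties of sigma-compact sets\<close>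

lemma sigma_compactI: "countable F \<Longrightarrow> (\<And>K. K \<in> F \<Longrightarrow> compact K) \<Longrightarrow> S = \<Union>F \<Longrightarrow> sigma_compact S"
  by (auto simp: sigma_compact_def)

lemma sigma_compact_closed:
  fixes S :: "'a::euclidean_space set"
  assumes "closed S"
  shows "sigma_compact S"
proof (rule sigma_compactI)
  show "S = \<Union>(range (\<lambda>n. S \<inter> cball 0 (real n)))"
    using real_arch_simple by auto
qed (use assms in \<open>auto intro: closed_Int_compact\<close>)

lemma sigma_compact_image:
  assumes "sigma_compact S" "continuous_on UNIV f"
  shows "sigma_compact (f ` S)"
proof -
  obtain F where F: "countable F" "\<And>K. K \<in> F \<Longrightarrow> compact K" "S = \<Union>F"
    using assms(1) by (auto simp: sigma_compact_def)
  then show ?thesis using assms(2)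
    by (intro sigma_compactI[of "image f ` F"])
      (auto intro!: compact_continuous_image intro: continuous_on_subset)
qed

lemma sigma_compact_Times:
  assumes "sigma_compact S" "sigma_compact T"
  shows "sigma_compact (S \<times> T)"
proof -
  obtain F G where F: "countable F" "\<And>K. K \<in> F \<Longrightarrow> compact K" "S = \<Union>F"
    and G: "countable G" "\<And>K. K \<in> G \<Longrightarrow> compact K" "T = \<Union>G"
    using assms by (auto simp: sigma_compact_def)
  then show ?thesis
    by (intro sigma_compactI[of "(\<lambda>(K, L). K \<times> L) ` (F \<times> G)"]) (auto intro!: compact_Times)
qed

lemma sigma_compact_Int_closed:
  assumes "sigma_compact S" "closed C"
  shows "sigma_compact (S \<inter> C)"
proof -
  obtain F where "countable F" "\<And>K. K \<in> F \<Longrightarrow> compact K" "S = \<Union>F"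
    using assms(1) by (auto simp: sigma_compact_def)
  then show ?thesis using assms(2)
    by (intro sigma_compactI[of "(\<lambda>K. K \<inter> C) ` F"]) (auto intro: compact_Int_closed)
qed

lemma sigma_compact_borel:
  fixes S :: "'a::t2_space set"
  assumes "sigma_compact S"
  shows "S \<in> sets borel"
proof -
  obtain F where "countable F" "\<And>K. K \<in> F \<Longrightarrow> compact K" "S = \<Union>F"
    using assms by (auto simp: sigma_compact_def)
  then show ?thesis by (auto intro!: sets.countable_Union[of F] dest: borel_compact)
qed

section \<open>The joint Krylov space as a function of its second generator\<close>

lemma krylov_0: "krylov 0 A S = {0}"
  by (simp add: krylov_def)

text \<open>Splitting off the two vectors of power \<open>t\<close> parametrises the space by the
  previous one and two scalars.\<close>

lemma krylov_Suc_pair: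
  "krylov (Suc t) A {b, u} = {x + c *\<^sub>R (((*v) A) ^^ t) b + e *\<^sub>R (((*v) A) ^^ t) u | x c e. x \<in> krylov t A {b, u}}"
    (is "_ = ?R")
proof -
  define S where "S = {(((*v) A) ^^ k) v | k v. k < t \<and> v \<in> {b, u}}"
  have "{(((*v) A) ^^ k) v | k v. k < Suc t \<and> v \<in> {b, u}}
      = insert ((((*v) A) ^^ t) b) (insert ((((*v) A) ^^ t) u) S)"
    by (auto simp: S_def less_Suc_eq)
  then have eq: "krylov (Suc t) A {b, u} = span (insert ((((*v) A) ^^ t) b) (insert ((((*v) A) ^^ t) u) S))"
    by (simp add: krylov_def)
  have "y \<in> krylov (Suc t) A {b, u} \<longleftrightarrow> y \<in> ?R" for y
  proof -
    have "y \<in> krylov (Suc t) A {b, u} \<longleftrightarrow>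
        (\<exists>c e. y - c *\<^sub>R (((*v) A) ^^ t) b - e *\<^sub>R (((*v) A) ^^ t) u \<in> krylov t A {b, u})"
      unfolding eq span_breakdown_eq by (simp add: krylov_def S_def)
    also have "\<dots> \<longleftrightarrow> y \<in> ?R"
    proof
      assume "\<exists>c e. y - c *\<^sub>R (((*v) A) ^^ t) b - e *\<^sub>R (((*v) A) ^^ t) u \<in> krylov t A {b, u}"
      then obtain c e where
        "y - c *\<^sub>R (((*v) A) ^^ t) b - e *\<^sub>R (((*v) A) ^^ t) u \<in> krylov t A {b, u}" by blast
      then show "y \<in> ?R"
        by (intro CollectI exI[of _ "y - c *\<^sub>R (((*v) A) ^^ t) b - e *\<^sub>R (((*v) A) ^^ t) u"]
            exI[of _ c] exI[of _ e]) simp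
    next
      assume "y \<in> ?R"
      then obtain x c e where
        "y = x + c *\<^sub>R (((*v) A) ^^ t) b + e *\<^sub>R (((*v) A) ^^ t) u" "x \<in> krylov t A {b, u}" by blast
      then show "\<exists>c e. y - c *\<^sub>R (((*v) A) ^^ t) b - e *\<^sub>R (((*v) A) ^^ t) u \<in> krylov t A {b, u}"
        by (intro exI[of _ c] exI[of _ e]) simp
    qed
    finally show ?thesis .
  qed
  then show ?thesis by blast
qed

lemma continuous_on_matrix_funpow:
  fixes A :: "real^'n^'n"
  shows "continuous_on S (\<lambda>u. (((*v) A) ^^ t) u)"
  by (induction t)
    (auto intro!: continuous_on_compose2[OF matrix_vector_mult_linear_continuous_on[of UNIV A]])

text \<open>The graph need not be closed, because the dimension can drop in the limit; but each step
  is a continuous image of the previous graph times a plane.\<close>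

lemma sigma_compact_krylov_graph:
  fixes A :: "real^'n^'n"
  shows "sigma_compact {(u, x). x \<in> krylov t A {b, u}}"
proof (induction t)
  case 0
  have "{(u, x). x \<in> krylov 0 A {b, u}} = (UNIV :: (real^'n) set) \<times> {0}"
    by (auto simp: krylov_0)
  then show ?case by (simp add: sigma_compact_closed closed_Times)
next
  case (Suc t)
  define f where "f = (\<lambda>((u, x), (c, e)). (u, x + c *\<^sub>R (((*v) A) ^^ t) b + e *\<^sub>R (((*v) A) ^^ t) u))"
  have "continuous_on UNIV f"
    unfolding f_def case_prod_unfold
    by (intro continuous_intros continuous_on_compose2[OF continuous_on_matrix_funpow[of UNIV]]) auto
  moreover have "{(u, x). x \<in> krylov (Suc t) A {b, u}} = f ` ({(u, x). x \<in> krylov t A {b, u}} \<times> (UNIV :: (real \<times> real) set))"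
    by (force simp: krylov_Suc_pair f_def image_iff)
  ultimately show ?case
    using sigma_compact_image[OF sigma_compact_Times[OF Suc sigma_compact_closed[OF closed_UNIV]]]
    by simp
qed

lemma borel_krylov_meets_closed:
  fixes A :: "real^'n^'n"
  assumes "closed C"
  shows "{u. \<exists>x\<in>krylov t A {b, u}. x \<in> C} \<in> sets borel"
proof -
  have "{u. \<exists>x\<in>krylov t A {b, u}. x \<in> C} = fst ` ({(u, x). x \<in> krylov t A {b, u}} \<inter> (UNIV \<times> C))"
    by force
  also have "sigma_compact \<dots>"
    using assms by (intro sigma_compact_image sigma_compact_Int_closed sigma_compact_krylov_graph
        closed_Times continuous_intros) auto
  finally show ?thesis by (rule sigma_compact_borel)
qed

section \<open>Trust-region and cubic-regularised problems\<close>

lemma continuous_on_quad_obj [continuous_intros]: "continuous_on S (quad_obj A b)"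
  unfolding quad_obj_def
  by (intro continuous_intros matrix_vector_mult_linear_continuous_on)

lemma continuous_on_cubic_obj [continuous_intros]: "continuous_on S (cubic_obj A b \<rho>)"
  unfolding cubic_obj_def by (intro continuous_intros)

text \<open>Turns a bound on a selected minimiser into an existence statement about the feasible
  set, independent of the selection.\<close>

lemma is_arg_min_le_iff:
  fixes f :: "'a \<Rightarrow> 'b::linorder"
  assumes "is_arg_min f P x"
  shows "f x \<le> c \<longleftrightarrow> (\<exists>y. P y \<and> f y \<le> c)"
  using assms by (metis is_arg_min_linorder order_trans)

theorem corollary5p2:
  fixes A :: "real^'d^'d" and b :: "real^'d" and R \<rho> \<delta> :: real
    and xtr xcr :: "real^'d"
    and M :: "'w measure" and u :: "'w \<Rightarrow> real^'d"
    and xhat_tr xhat_cr :: "nat \<Rightarrow> 'w \<Rightarrow> real^'d"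
  assumes "transpose A = A" and "R > 0" and "\<rho> \<ge> 0"
    and "is_arg_min (quad_obj A b) (\<lambda>x. norm x \<le> R) xtr"
    and "is_arg_min (cubic_obj A b \<rho>) (\<lambda>x. True) xcr"
    and "0 < \<delta>" and "\<delta> < 1"
    and "prob_space M" and "u \<in> borel_measurable M" and "distr M borel u = uniform_sphere"
    and "\<And>t \<omega>. t \<ge> 1 \<Longrightarrow> \<omega> \<in> space M \<Longrightarrow>
           is_arg_min (quad_obj A b) (\<lambda>x. x \<in> krylov t A {b, u \<omega>} \<and> norm x \<le> R) (xhat_tr t \<omega>)"
    and "\<And>t \<omega>. t \<ge> 1 \<Longrightarrow> \<omega> \<in> space M \<Longrightarrow>
           is_arg_min (cubic_obj A b \<rho>) (\<lambda>x. x \<in> krylov t A {b, u \<omega>}) (xhat_cr t \<omega>)"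
  shows "measure M {\<omega> \<in> space M. \<forall>t\<ge>1.
           quad_obj A b (xhat_tr t \<omega>) - quad_obj A b xtr
             \<le> (lambda_max A - lambda_min A) * R^2 / (real t)^2
                * (4 + of_bool (lambda_min A < 0) / 2 * (ln (4 * real CARD('d) / \<delta>^2))^2)
         \<and> cubic_obj A b \<rho> (xhat_cr t \<omega>) - cubic_obj A b \<rho> xcr
             \<le> (lambda_max A - lambda_min A) * (norm xcr)^2 / (real t)^2
                * (4 + of_bool (lambda_min A < 0) / 2 * (ln (4 * real CARD('d) / \<delta>^2))^2)}
         \<ge> 1 - \<delta>"
proof -
  define q where "q = 4 + of_bool (lambda_min A < 0) / 2 * (ln (4 * real CARD('d) / \<delta>^2))^2"
  define bnd where "bnd r t = (lambda_max A - lambda_min A) * r^2 / (real t)^2 * q" for r t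
  \<comment> \<open>The good event in terms of the direction alone: existence of a Krylov point
    replaces the selected minimisers.\<close>
  define G where "G = {v. \<forall>t\<ge>1.
      (\<exists>x\<in>krylov t A {b, v}. x \<in> {x. norm x \<le> R \<and> quad_obj A b x \<le> quad_obj A b xtr + bnd R t}) \<and>
      (\<exists>x\<in>krylov t A {b, v}. x \<in> {x. cubic_obj A b \<rho> x \<le> cubic_obj A b \<rho> xcr + bnd (norm xcr) t})}"
  obtain B where "symmetric_eigenbasis A B" using symmetric_eigenbasis_exists[OF assms(1)] by blast
  then interpret symmetric_eigenbasis A B .
  obtain v0 where v0: "v0 \<in> B" "eigval_of A v0 = lambda_min A" using lambda_min_attained by blast
  \<comment> \<open>One condition, independent of \<open>t\<close> and of the problem, serves all
    iterations and both bounds, so no union bound is taken.\<close>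
  define U where "U = {v. norm v \<le> 1 \<and> 3 * \<delta> / (8 * sqrt (real CARD('d))) \<le> \<bar>v \<bullet> v0\<bar>}"

  have "closed {x. norm x \<le> R \<and> quad_obj A b x \<le> quad_obj A b xtr + bnd R t}"
    "closed {x. cubic_obj A b \<rho> x \<le> cubic_obj A b \<rho> xcr + bnd (norm xcr) t}" for t
    by (intro closed_Collect_conj closed_Collect_le continuous_intros)+
  note meas = this[THEN borel_krylov_meets_closed]
  have G: "G \<in> sets borel"
  proof -
    have "G = (\<Inter>t\<in>{1..}.
        {v. \<exists>x\<in>krylov t A {b, v}. x \<in> {x. norm x \<le> R \<and> quad_obj A b x \<le> quad_obj A b xtr + bnd R t}} \<inter>
        {v. \<exists>x\<in>krylov t A {b, v}. x \<in> {x. cubic_obj A b \<rho> x \<le> cubic_obj A b \<rho> xcr + bnd (norm xcr) t}})"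
      unfolding G_def by fastforce
    then show ?thesis using meas by (auto intro!: sets.countable_INT'' sets.Int)
  qed

  have near: "\<exists>x\<in>krylov t A {b, v}. norm x \<le> r \<and> quad_obj A b x \<le> quad_obj A b w + bnd r t"
    if "v \<in> U" "t \<ge> 1" "norm w \<le> r" for v t w r
  proof -
    have "real CARD('d) \<ge> 1" by (simp add: Suc_leI)
    from krylov_near_minimizer[OF v0 _ assms(6,7) this, of v t w r b] that show ?thesis
      by (force simp: U_def bnd_def q_def)
  qed
  have xcr_ball: "quad_obj A b xcr \<le> quad_obj A b x" if "norm x \<le> norm xcr" for x
  proof -
    have "cubic_obj A b \<rho> xcr \<le> cubic_obj A b \<rho> x"
      using assms(5) by (simp add: is_arg_min_linorder)
    moreover have "\<rho> / 3 * norm x ^ 3 \<le> \<rho> / 3 * norm xcr ^ 3"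
      using that assms(3) by (intro mult_left_mono power_mono) auto
    ultimately show ?thesis by (simp add: cubic_obj_def)
  qed
  have "U \<subseteq> G"
  proof
    fix v assume v: "v \<in> U"
    have "norm xtr \<le> R" using assms(4) by (simp add: is_arg_min_def)
    then have "\<exists>x\<in>krylov t A {b, v}. norm x \<le> R \<and> quad_obj A b x \<le> quad_obj A b xtr + bnd R t"
      if "t \<ge> 1" for t using near[OF v that] by blast
    moreover have "\<exists>x\<in>krylov t A {b, v}. cubic_obj A b \<rho> x \<le> cubic_obj A b \<rho> xcr + bnd (norm xcr) t"
      if "t \<ge> 1" for t
    proof -
      obtain x where x: "x \<in> krylov t A {b, v}" "norm x \<le> norm xcr"
          "quad_obj A b x \<le> quad_obj A b xcr + bnd (norm xcr) t"
        using near[OF v \<open>t \<ge> 1\<close>, of xcr "norm xcr"] by auto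
      \<comment> \<open>Staying in the ball of radius \<open>norm xcr\<close> keeps the cubic
        penalty below that of \<open>xcr\<close>, so the bound for the quadratic carries
        over.\<close>
      have "\<rho> / 3 * norm x ^ 3 \<le> \<rho> / 3 * norm xcr ^ 3"
        using x(2) assms(3) by (intro mult_left_mono power_mono) auto
      with x show ?thesis by (intro bexI[of _ x]) (simp_all add: cubic_obj_def)
    qed
    ultimately show "v \<in> G" by (simp add: G_def)
  qed
  have "1 - \<delta> \<le> measure uniform_sphere U"
    using uniform_sphere_anticoncentration[OF unit[OF v0(1)] assms(6,7)] by (simp add: U_def)
  also have "\<dots> \<le> measure uniform_sphere G"
    using \<open>U \<subseteq> G\<close> G finite_measure.finite_measure_mono[OF prob_space.finite_measure[OF prob_space_uniform_sphere]]
    by auto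
  also have "\<dots> = measure M (u -` G \<inter> space M)"
    unfolding assms(10)[symmetric] using assms(9) G by (rule measure_distr)
  \<comment> \<open>Equality, and not just inclusion, is what makes the event of the theorem
    measurable.\<close>
  also have "u -` G \<inter> space M = {\<omega> \<in> space M. \<forall>t\<ge>1.
      quad_obj A b (xhat_tr t \<omega>) - quad_obj A b xtr \<le> bnd R t
      \<and> cubic_obj A b \<rho> (xhat_cr t \<omega>) - cubic_obj A b \<rho> xcr \<le> bnd (norm xcr) t}"
  proof -
    have "quad_obj A b (xhat_tr t \<omega>) - quad_obj A b xtr \<le> bnd R t \<longleftrightarrow> (\<exists>x\<in>krylov t A {b, u \<omega>}.
          x \<in> {x. norm x \<le> R \<and> quad_obj A b x \<le> quad_obj A b xtr + bnd R t})"
      "cubic_obj A b \<rho> (xhat_cr t \<omega>) - cubic_obj A b \<rho> xcr \<le> bnd (norm xcr) t \<longleftrightarrow>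
        (\<exists>x\<in>krylov t A {b, u \<omega>}. x \<in> {x. cubic_obj A b \<rho> x \<le> cubic_obj A b \<rho> xcr + bnd (norm xcr) t})"
      if "t \<ge> 1" "\<omega> \<in> space M" for t \<omega>
      unfolding diff_le_eq add.commute[of "bnd _ _"] is_arg_min_le_iff[OF assms(11)[OF that]]
        is_arg_min_le_iff[OF assms(12)[OF that]] by blast+
    then show ?thesis unfolding G_def by (intro set_eqI) auto
  qed
  finally show ?thesis by (simp only: bnd_def q_def)
qed

end
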